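(* For every $k$, there is a polynomial-time reduction from the DISC-SC-$k$ problem to the $(s,z,t)$-Temporal Separator problem restricted to temporal graphs whose underlying graph has pathwidth at most $2k+6$.
   Context: DISC-SC: given a finite set $\Gamma$ of segments (intervals) on the rational line and a finite set $\mathcal{I}$ of unit-length intervals on the rational line, find a minimum-size subset $A\subseteq\mathcal{I}$ covering all segments of $\Gamma$, where an interval $I$ covers a segment $C$ if at least one endpoint of $C$ lies in $I$, and $A$ covers $C$ if some $I\in A$ covers $C$. DISC-SC-$k$ is the restriction of DISC-SC to instances where every segment in $\Gamma$ has length at most $k$. A temporal graph $G=(V,E,\tau)$ consists of a finite vertex set $V$ and a set of time-labelled undirected edges $E \subseteq V\times V\times[\tau]$ ($(u,v,t')\in E$ iff $(v,u,t')\in E$, no loops); its underlying graph $G_\downarrow$ is the static graph on $V$ containing $\{u,v\}$ iff $(u,v,t')\in E$ for some $t'$. An $(s,z)$-temporal path is a sequence of edges $(u_1,v_1,t_1),\dots,(u_k,v_k,t_k)$ forming a path from $s$ to $z$ with $t_1\le\dots\le t_k$; its travelling time is $t_k-t_1+1$, and it is an $(s,z,t)$-temporal path if this is at most $t$. An $(s,z,t)$-temporal separator is a set $S\subseteq V\setminus\{s,z\}$ meeting every $(s,z,t)$-temporal path; the $(s,z,t)$-Temporal Separator problem asks for one of minimum size. Pathwidth is the standard graph parameter (minimum over path decompositions of the maximum bag size minus one). *)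

theory Defs
  imports Complex_Main "HOL-Computational_Algebra.Polynomial"
begin

section \<open>Polynomial-time computation\<close>

text \<open>The machine model is the WHILE language over binary trees (N. D. Jones, Computability and
  Complexity from a Programming Perspective). Every operation is charged the size of its
  result, so the store of a run has size at most linear in input size plus cost.
  With this charge (unlike with unit cost, where repeated doubling by Cons builds exponentially
  large trees), WHILE programs and Turing machines simulate each other with polynomial
  overhead, also for functions.\<close>

datatype tree = Leaf | Node tree tree

fun tsize :: "tree \<Rightarrow> nat" where
  "tsize Leaf = 1"
| "tsize (Node l r) = 1 + tsize l + tsize r"

fun left :: "tree \<Rightarrow> tree" where
  "left Leaf = Leaf"
| "left (Node l r) = l"

fun right :: "tree \<Rightarrow> tree" where
  "right Leaf = Leaf"
| "right (Node l r) = r"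

type_synonym state = "nat \<Rightarrow> tree"

datatype expr = Var nat | Empty | Cons expr expr | Hd expr | Tl expr

fun eval_expr :: "expr \<Rightarrow> state \<Rightarrow> tree" where
  "eval_expr (Var x) \<sigma> = \<sigma> x"
| "eval_expr Empty \<sigma> = Leaf"
| "eval_expr (Cons d e) \<sigma> = Node (eval_expr d \<sigma>) (eval_expr e \<sigma>)"
| "eval_expr (Hd e) \<sigma> = left (eval_expr e \<sigma>)"
| "eval_expr (Tl e) \<sigma> = right (eval_expr e \<sigma>)"

fun expr_cost :: "expr \<Rightarrow> state \<Rightarrow> nat" where
  "expr_cost (Var x) \<sigma> = tsize (\<sigma> x)"
| "expr_cost Empty \<sigma> = 1"
| "expr_cost (Cons d e) \<sigma> =
     expr_cost d \<sigma> + expr_cost e \<sigma> + tsize (eval_expr (Cons d e) \<sigma>)"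
| "expr_cost (Hd e) \<sigma> = expr_cost e \<sigma> + tsize (eval_expr (Hd e) \<sigma>)"
| "expr_cost (Tl e) \<sigma> = expr_cost e \<sigma> + tsize (eval_expr (Tl e) \<sigma>)"

datatype com =
    Skip
  | Assign nat expr
  | Seq com com
  | If expr com com
  | While expr com

text \<open>\<open>exec c \<sigma> n \<sigma>'\<close>: started in \<open>\<sigma>\<close>, the program \<open>c\<close> terminates in \<open>\<sigma>'\<close> at cost \<open>n\<close>.
  \<open>Leaf\<close> is the only false value.\<close>

inductive exec :: "com \<Rightarrow> state \<Rightarrow> nat \<Rightarrow> state \<Rightarrow> bool" where
  Skip: "exec Skip \<sigma> 1 \<sigma>"
| Assign: "exec (Assign x e) \<sigma> (1 + expr_cost e \<sigma>) (\<sigma>(x := eval_expr e \<sigma>))"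
| Seq: "exec c \<sigma> m \<sigma>' \<Longrightarrow> exec d \<sigma>' n \<sigma>'' \<Longrightarrow> exec (Seq c d) \<sigma> (1 + m + n) \<sigma>''"
| IfTrue: "eval_expr e \<sigma> \<noteq> Leaf \<Longrightarrow> exec c \<sigma> n \<sigma>'
    \<Longrightarrow> exec (If e c d) \<sigma> (1 + expr_cost e \<sigma> + n) \<sigma>'"
| IfFalse: "eval_expr e \<sigma> = Leaf \<Longrightarrow> exec d \<sigma> n \<sigma>'
    \<Longrightarrow> exec (If e c d) \<sigma> (1 + expr_cost e \<sigma> + n) \<sigma>'"
| WhileFalse: "eval_expr e \<sigma> = Leaf \<Longrightarrow> exec (While e c) \<sigma> (1 + expr_cost e \<sigma>) \<sigma>"
| WhileTrue: "eval_expr e \<sigma> \<noteq> Leaf \<Longrightarrow> exec c \<sigma> m \<sigma>' \<Longrightarrow> exec (While e c) \<sigma>' n \<sigma>''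
    \<Longrightarrow> exec (While e c) \<sigma> (1 + expr_cost e \<sigma> + m + n) \<sigma>''"

text \<open>Input and output are held in variable \<open>0\<close>; all other variables are initially \<open>Leaf\<close>.\<close>

definition init_state :: "tree \<Rightarrow> state" where
  "init_state d = (\<lambda>x. if x = 0 then d else Leaf)"

definition polytime_on :: "('a \<Rightarrow> tree) \<Rightarrow> ('b \<Rightarrow> tree) \<Rightarrow> 'a set \<Rightarrow> ('a \<Rightarrow> 'b) \<Rightarrow> bool" where
  "polytime_on enc_in enc_out D f \<longleftrightarrow>
     (\<exists>(c :: com) (p :: nat poly). \<forall>x\<in>D. \<exists>n \<sigma>.
        exec c (init_state (enc_in x)) n \<sigma> \<and> \<sigma> 0 = enc_out (f x) \<and>
        n \<le> poly p (tsize (enc_in x)))"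


section \<open>Encodings\<close>

definition enc_bool :: "bool \<Rightarrow> tree" where
  "enc_bool b = (if b then Node Leaf Leaf else Leaf)"

text \<open>Numbers are written in binary, least significant bit first.\<close>

fun enc_nat :: "nat \<Rightarrow> tree" where
  "enc_nat n = (if n = 0 then Leaf else Node (enc_bool (odd n)) (enc_nat (n div 2)))"

declare enc_nat.simps [simp del]

definition enc_pair :: "('a \<Rightarrow> tree) \<Rightarrow> ('b \<Rightarrow> tree) \<Rightarrow> 'a \<times> 'b \<Rightarrow> tree" where
  "enc_pair ea eb x = Node (ea (fst x)) (eb (snd x))"

fun enc_list :: "('a \<Rightarrow> tree) \<Rightarrow> 'a list \<Rightarrow> tree" where
  "enc_list ea [] = Leaf"
| "enc_list ea (x # xs) = Node (ea x) (enc_list ea xs)"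

definition enc_int :: "int \<Rightarrow> tree" where
  "enc_int i = Node (enc_bool (i < 0)) (enc_nat (nat \<bar>i\<bar>))"

definition enc_rat :: "rat \<Rightarrow> tree" where
  "enc_rat q = enc_pair enc_int enc_int (quotient_of q)"


section \<open>Minimisation problems and reductions between them\<close>

record ('i, 's) min_problem =
  instances :: "'i set"
  feasible :: "'i \<Rightarrow> 's set"
  objective :: "'s \<Rightarrow> nat"
  enc_inst :: "'i \<Rightarrow> tree"
  enc_sol :: "'s \<Rightarrow> tree"

definition optimal :: "('i, 's) min_problem \<Rightarrow> 'i \<Rightarrow> 's \<Rightarrow> bool" where
  "optimal P x y \<longleftrightarrow>
     y \<in> feasible P x \<and> (\<forall>y'\<in>feasible P x. objective P y \<le> objective P y')"

text \<open>A polynomial-time reduction consists of an instance map \<open>f\<close>, a map \<open>h\<close> on thresholds and a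
  solution map \<open>g\<close>, all polynomial-time computable. Conditions (1) and (2) make
  \<open>(x, q) \<mapsto> (f x, h (x, q))\<close> a many-one (Karp) reduction between the decision versions;
  conditions (1) and (3) together with the implied equivalence of solvability of \<open>x\<close> and \<open>f x\<close>
  make \<open>(f, g)\<close> a Levin reduction between the search problems of finding an optimal solution.\<close>

definition poly_reduces :: "('i, 's) min_problem \<Rightarrow> ('j, 'u) min_problem \<Rightarrow> bool" where
  "poly_reduces P Q \<longleftrightarrow> (\<exists>f h g.
     polytime_on (enc_inst P) (enc_inst Q) (instances P) f \<and>
     polytime_on (enc_pair (enc_inst P) enc_nat) enc_nat (instances P \<times> UNIV) h \<and>
     polytime_on (enc_pair (enc_inst P) (enc_sol Q)) (enc_sol P)
       {(x, y). x \<in> instances P \<and> optimal Q (f x) y} g \<and>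
     (\<forall>x\<in>instances P.
        \<comment> \<open>(1)\<close> f x \<in> instances Q \<and>
        \<comment> \<open>(2)\<close> (\<forall>q. (\<exists>y\<in>feasible P x. objective P y \<le> q) \<longleftrightarrow>
                    (\<exists>y\<in>feasible Q (f x). objective Q y \<le> h (x, q))) \<and>
        \<comment> \<open>(3)\<close> (\<forall>y. optimal Q (f x) y \<longrightarrow> optimal P x (g (x, y)))))"


section \<open>Discrete segment covering\<close>

text \<open>A pair \<open>(a, b)\<close> with \<open>a \<le> b\<close> stands for the closed interval from \<open>a\<close> to \<open>b\<close>.\<close>

type_synonym interval = "rat \<times> rat"

definition covers :: "interval \<Rightarrow> interval \<Rightarrow> bool" where
  "covers I C \<longleftrightarrow> fst C \<in> {fst I..snd I} \<or> snd C \<in> {fst I..snd I}"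

definition segment_cover :: "interval set \<Rightarrow> interval set \<Rightarrow> interval set \<Rightarrow> bool" where
  "segment_cover \<Gamma> \<I> A \<longleftrightarrow> A \<subseteq> \<I> \<and> (\<forall>C\<in>\<Gamma>. \<exists>I\<in>A. covers I C)"

text \<open>Finite sets are presented to programs as lists; order and repetitions are irrelevant,
  and the objective counts distinct elements.\<close>

definition DISC_SC_k :: "nat \<Rightarrow> (interval list \<times> interval list, interval list) min_problem" where
  "DISC_SC_k k = \<lparr>
     instances = {(\<Gamma>, \<I>).
       (\<forall>(a, b)\<in>set \<Gamma>. a \<le> b \<and> b - a \<le> of_nat k) \<and> (\<forall>(l, r)\<in>set \<I>. r - l = 1)},
     feasible = (\<lambda>(\<Gamma>, \<I>). {A. segment_cover (set \<Gamma>) (set \<I>) (set A)}),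
     objective = (\<lambda>A. card (set A)),
     enc_inst = enc_pair (enc_list (enc_pair enc_rat enc_rat)) (enc_list (enc_pair enc_rat enc_rat)),
     enc_sol = enc_list (enc_pair enc_rat enc_rat) \<rparr>"


section \<open>Pathwidth\<close>

definition path_decomposition :: "'v set \<Rightarrow> 'v set set \<Rightarrow> 'v set list \<Rightarrow> bool" where
  "path_decomposition V E Bs \<longleftrightarrow>
     Bs \<noteq> [] \<and> \<Union>(set Bs) = V \<and>
     (\<forall>e\<in>E. \<exists>B\<in>set Bs. e \<subseteq> B) \<and>
     (\<forall>i j l. i \<le> j \<and> j \<le> l \<and> l < length Bs \<longrightarrow> Bs ! i \<inter> Bs ! l \<subseteq> Bs ! j)"

definition decomposition_width :: "'v set list \<Rightarrow> nat" where
  "decomposition_width Bs = Max (card ` set Bs) - 1"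

definition pathwidth :: "'v set \<Rightarrow> 'v set set \<Rightarrow> nat" where
  "pathwidth V E = (INF Bs \<in> {Bs. path_decomposition V E Bs}. decomposition_width Bs)"


section \<open>Temporal graphs and temporal separators\<close>

text \<open>An edge \<open>(u, v, i)\<close> joins \<open>u\<close> and \<open>v\<close> at time \<open>i\<close>.\<close>

type_synonym 'v tedge = "'v \<times> 'v \<times> nat"

abbreviation src :: "'v tedge \<Rightarrow> 'v" where "src e \<equiv> fst e"
abbreviation dst :: "'v tedge \<Rightarrow> 'v" where "dst e \<equiv> fst (snd e)"
abbreviation time :: "'v tedge \<Rightarrow> nat" where "time e \<equiv> snd (snd e)"

definition temporal_graph :: "'v set \<Rightarrow> 'v tedge set \<Rightarrow> nat \<Rightarrow> bool" where
  "temporal_graph V E \<tau> \<longleftrightarrow>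
     finite V \<and> E \<subseteq> V \<times> V \<times> {1..\<tau>} \<and>
     (\<forall>u v i. (u, v, i) \<in> E \<longleftrightarrow> (v, u, i) \<in> E) \<and> (\<forall>v i. (v, v, i) \<notin> E)"

definition underlying_edges :: "'v tedge set \<Rightarrow> 'v set set" where
  "underlying_edges E = {{u, v} | u v i. (u, v, i) \<in> E}"

definition temporal_path :: "'v tedge set \<Rightarrow> 'v \<Rightarrow> 'v \<Rightarrow> 'v tedge list \<Rightarrow> bool" where
  "temporal_path E s z p \<longleftrightarrow>
     p \<noteq> [] \<and> set p \<subseteq> E \<and> src (hd p) = s \<and> dst (last p) = z \<and>
     (\<forall>i. Suc i < length p \<longrightarrow> dst (p ! i) = src (p ! Suc i) \<and> time (p ! i) \<le> time (p ! Suc i)) \<and>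
     distinct (s # map dst p)"

definition travelling_time :: "'v tedge list \<Rightarrow> nat" where
  "travelling_time p = time (last p) - time (hd p) + 1"

definition path_vertices :: "'v tedge list \<Rightarrow> 'v set" where
  "path_vertices p = src ` set p \<union> dst ` set p"

definition temporal_separator ::
  "'v set \<Rightarrow> 'v tedge set \<Rightarrow> 'v \<Rightarrow> 'v \<Rightarrow> nat \<Rightarrow> 'v set \<Rightarrow> bool" where
  "temporal_separator V E s z t S \<longleftrightarrow>
     S \<subseteq> V - {s, z} \<and>
     (\<forall>p. temporal_path E s z p \<and> travelling_time p \<le> t \<longrightarrow> S \<inter> path_vertices p \<noteq> {})"

record ts_instance =
  vertices :: "nat list"
  tedges :: "nat tedge list"
  lifetime :: nat
  source :: nat
  target :: nat
  deadline :: nat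

definition enc_ts_instance :: "ts_instance \<Rightarrow> tree" where
  "enc_ts_instance G =
     Node (enc_list enc_nat (vertices G))
    (Node (enc_list (enc_pair enc_nat (enc_pair enc_nat enc_nat)) (tedges G))
    (Node (enc_nat (lifetime G))
    (Node (enc_nat (source G))
    (Node (enc_nat (target G))
          (enc_nat (deadline G))))))"

definition Temporal_Separator_pw :: "nat \<Rightarrow> (ts_instance, nat list) min_problem" where
  "Temporal_Separator_pw w = \<lparr>
     instances = {G.
       temporal_graph (set (vertices G)) (set (tedges G)) (lifetime G) \<and>
       source G \<in> set (vertices G) \<and> target G \<in> set (vertices G) \<and> source G \<noteq> target G \<and>
       0 < deadline G \<and>
       pathwidth (set (vertices G)) (underlying_edges (set (tedges G))) \<le> w},
     feasible = (\<lambda>G. {S. temporal_separator (set (vertices G)) (set (tedges G))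
                           (source G) (target G) (deadline G) (set S)}),
     objective = (\<lambda>S. card (set S)),
     enc_inst = enc_ts_instance,
     enc_sol = enc_list enc_nat \<rparr>"

end

theory Submission
  imports Defs
begin

text \<open>Sort the unit intervals by their left ends. The intervals containing a given point are then
  consecutive, so a segment is covered iff the chosen set meets one of two runs of consecutive
  intervals, one for each end of the segment. Every segment gets a time label of its own, and the
  edges with this label form a path from the source to the target through the two runs. For
  deadline \<open>1\<close> a temporal path stays inside one label, so a separator is precisely a set meeting
  the inner vertices of all these paths.

  The edge leading from the first run to the second would destroy bounded pathwidth. It is therefore
  routed through a hub vertex belonging to an interval \<open>J\<close> that contains the left end of the segment.
  Choosing a hub only helps against segments covered by \<open>J\<close>, so a hub in a separator can be replaced
  by \<open>J\<close>. The intervals with hubs are thinned out such that among any three of them the first and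
  the third are disjoint, but still every point covered at all is covered by one of them. A hub has
  to stay in the bags for a range of length \<open>k + 1\<close>, so at most \<open>2k + 2\<close> hubs are present at a
  time, next to the source, the target and two consecutive intervals.

  An instance without a solution contains a segment with both runs empty; its path is a single edge
  from the source to the target, and no separator exists either.\<close>

subsection \<open>WHILE programs and polynomial bounds\<close>

text \<open>Arbitrarily many direct edges between the two runs, with pairwise different ends, may
  pass over one point. The hubs bundle them. Besides the target, a hub of \<open>J\<close> is
  adjacent only to intervals that start between \<open>fst J\<close> and \<open>snd J + k\<close>:
  with p the left end of a segment and p in \<open>J\<close>, the last member of the first run
  starts between \<open>fst J\<close> and p, and the first member of the second run starts after p
  and not after p + k. As \<open>J\<close> has length one, this window has length k + 1. Any closed
  unit window contains at most two left ends of hub intervals, so a bag has at most 2 + 2 + 2(k + 1)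
  vertices.

  The second obstacle is that polynomial time refers to concrete WHILE programs. Closure properties
  are therefore proved once, and all constructions are phrased with folds, maps and filters so as to
  fall under them. The delicate closure property is the one for folds, since iterating a
  polynomial-time step can produce exponentially large values. The reduction only compares
  rationals, which comes down to integer products, and it names vertices and times by ranks.\<close>

definition poly_bounded :: "(nat \<Rightarrow> nat) \<Rightarrow> bool" where
  "poly_bounded g \<longleftrightarrow> (\<exists>p. \<forall>n. g n \<le> poly p n)"

lemma poly_nat_mono: "a \<le> b \<Longrightarrow> poly p a \<le> poly p b" for p :: "nat poly"
  by (induction p) (auto intro!: add_mono mult_mono)

lemma poly_bounded_id: "poly_bounded (\<lambda>n. n)"
  unfolding poly_bounded_def by (rule exI[of _ "[:0, 1:]"]) simp

lemma poly_bounded_const: "poly_bounded (\<lambda>n. c)"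
  unfolding poly_bounded_def by (rule exI[of _ "[:c:]"]) simp

lemma poly_bounded_add: "poly_bounded f \<Longrightarrow> poly_bounded g \<Longrightarrow> poly_bounded (\<lambda>n. f n + g n)"
  unfolding poly_bounded_def by (metis add_mono poly_add)

lemma poly_bounded_mult: "poly_bounded f \<Longrightarrow> poly_bounded g \<Longrightarrow> poly_bounded (\<lambda>n. f n * g n)"
  unfolding poly_bounded_def by (metis mult_le_mono poly_mult)

lemma poly_bounded_poly: "poly_bounded f \<Longrightarrow> poly_bounded (\<lambda>n. poly p (f n))"
  unfolding poly_bounded_def by (metis order_trans poly_nat_mono poly_pcompose)

lemmas poly_bounded_intros = poly_bounded_const poly_bounded_id poly_bounded_add poly_bounded_mult
  poly_bounded_poly

section \<open>Frame property and growth of the store\<close>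

fun expr_vars :: "expr \<Rightarrow> nat set" where
  "expr_vars (Var x) = {x}"
| "expr_vars Empty = {}"
| "expr_vars (Cons d e) = expr_vars d \<union> expr_vars e"
| "expr_vars (Hd e) = expr_vars e"
| "expr_vars (Tl e) = expr_vars e"

fun com_vars :: "com \<Rightarrow> nat set" where
  "com_vars Skip = {}"
| "com_vars (Assign x e) = insert x (expr_vars e)"
| "com_vars (Seq c d) = com_vars c \<union> com_vars d"
| "com_vars (If e c d) = expr_vars e \<union> com_vars c \<union> com_vars d"
| "com_vars (While e c) = expr_vars e \<union> com_vars c"

lemma finite_expr_vars: "finite (expr_vars e)"
  by (induction e) auto

lemma finite_com_vars: "finite (com_vars c)"
  by (induction c) (auto simp: finite_expr_vars)

lemma expr_frame:
  "y \<notin> expr_vars e \<Longrightarrow> eval_expr e (\<sigma>(y := v)) = eval_expr e \<sigma>"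
  "y \<notin> expr_vars e \<Longrightarrow> expr_cost e (\<sigma>(y := v)) = expr_cost e \<sigma>"
  by (induction e) auto

text \<open>Neither values nor costs of expressions depend on variables that do not occur in them.
  This lets a program written for an otherwise empty store run while its caller keeps data in a
  fresh variable.\<close>

lemma exec_frame:
  "exec c \<sigma> n \<sigma>' \<Longrightarrow> y \<notin> com_vars c \<Longrightarrow> exec c (\<sigma>(y := v)) n (\<sigma>'(y := v))"
proof (induction rule: exec.induct)
  case (Skip \<sigma>)
  show ?case by (rule exec.Skip)
next
  case (Assign x e \<sigma>)
  then have xy: "x \<noteq> y" and y: "y \<notin> expr_vars e" by auto
  show ?case
    using exec.Assign[of x e "\<sigma>(y := v)"]
    by (simp only: expr_frame[OF y] fun_upd_twist[OF xy[symmetric]])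
next
  case (Seq c \<sigma> m \<sigma>' d n \<sigma>'')
  then have "y \<notin> com_vars c" "y \<notin> com_vars d" by auto
  then show ?case by (rule exec.Seq[OF Seq.IH])
next
  case (IfTrue e \<sigma> c n \<sigma>' d)
  then have y: "y \<notin> expr_vars e" "y \<notin> com_vars c" by auto
  have "eval_expr e (\<sigma>(y := v)) \<noteq> Leaf" using IfTrue.hyps(1) expr_frame(1)[OF y(1)] by metis
  from exec.IfTrue[OF this IfTrue.IH[OF y(2)]] show ?case by (simp only: expr_frame[OF y(1)])
next
  case (IfFalse e \<sigma> d n \<sigma>' c)
  then have y: "y \<notin> expr_vars e" "y \<notin> com_vars d" by auto
  have "eval_expr e (\<sigma>(y := v)) = Leaf" using IfFalse.hyps(1) expr_frame(1)[OF y(1)] by metis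
  from exec.IfFalse[OF this IfFalse.IH[OF y(2)]] show ?case by (simp only: expr_frame[OF y(1)])
next
  case (WhileFalse e \<sigma> c)
  then have y: "y \<notin> expr_vars e" by auto
  have "eval_expr e (\<sigma>(y := v)) = Leaf" using WhileFalse.hyps(1) expr_frame(1)[OF y] by metis
  from exec.WhileFalse[OF this] show ?case by (simp only: expr_frame[OF y])
next
  case (WhileTrue e \<sigma> c m \<sigma>' n \<sigma>'')
  then have y: "y \<notin> expr_vars e" "y \<notin> com_vars c" by auto
  have "eval_expr e (\<sigma>(y := v)) \<noteq> Leaf" using WhileTrue.hyps(1) expr_frame(1)[OF y(1)] by metis
  from exec.WhileTrue[OF this WhileTrue.IH(1)[OF y(2)] WhileTrue.IH(2)[OF WhileTrue.prems]]
  show ?case by (simp only: expr_frame[OF y(1)])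
qed

lemma tsize_pos: "0 < tsize t"
  by (cases t) auto

lemma tsize_eval_le_cost: "tsize (eval_expr e \<sigma>) \<le> expr_cost e \<sigma>"
  by (induction e) auto

text \<open>An assignment is charged at least the size of the value that it stores. Running time
  thus controls the size of the output, which composition needs.\<close>

lemma exec_size:
  "exec c \<sigma> n \<sigma>' \<Longrightarrow> \<forall>x. tsize (\<sigma> x) \<le> M \<Longrightarrow> \<forall>x. tsize (\<sigma>' x) \<le> M + n"
proof (induction arbitrary: M rule: exec.induct)
  case (Assign x e \<sigma>)
  then show ?case using tsize_eval_le_cost[of e \<sigma>]
    by (auto simp: trans_le_add2 intro!: le_SucI trans_le_add1)
next
  case (Seq c \<sigma> m \<sigma>' d n \<sigma>'')
  from Seq.IH(2)[OF Seq.IH(1)[OF Seq.prems]] show ?case by (auto intro: order_trans)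
next
  case (WhileTrue e \<sigma> c m \<sigma>' n \<sigma>'')
  from WhileTrue.IH(2)[OF WhileTrue.IH(1)[OF WhileTrue.prems]] show ?case
    by (auto intro: order_trans)
next
  case (IfTrue e \<sigma> c n \<sigma>' d)
  from IfTrue.IH[OF IfTrue.prems] show ?case by (auto intro: order_trans)
next
  case (IfFalse e \<sigma> c n \<sigma>' d)
  from IfFalse.IH[OF IfFalse.prems] show ?case by (auto intro: order_trans)
qed (auto intro!: le_SucI trans_le_add1)

definition runs :: "com \<Rightarrow> state \<Rightarrow> state \<Rightarrow> nat \<Rightarrow> bool" where
  "runs c \<sigma> \<sigma>' b \<longleftrightarrow> (\<exists>n\<le>b. exec c \<sigma> n \<sigma>')"

lemma runs_Seq: "runs c \<sigma> \<sigma>' a \<Longrightarrow> runs d \<sigma>' \<sigma>'' b \<Longrightarrow> runs (Seq c d) \<sigma> \<sigma>'' (1 + a + b)"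
  unfolding runs_def by (metis add_le_mono add_le_mono1 exec.Seq nat_add_left_cancel_le)

lemma runs_Assign:
  "expr_cost e \<sigma> \<le> b \<Longrightarrow> \<sigma>' = \<sigma>(x := eval_expr e \<sigma>) \<Longrightarrow> runs (Assign x e) \<sigma> \<sigma>' (1 + b)"
  unfolding runs_def using exec.Assign by fastforce

lemma runs_IfTrue:
  "eval_expr e \<sigma> \<noteq> Leaf \<Longrightarrow> expr_cost e \<sigma> \<le> a \<Longrightarrow> runs c \<sigma> \<sigma>' b \<Longrightarrow> runs (If e c d) \<sigma> \<sigma>' (1 + a + b)"
  unfolding runs_def by (meson add_le_mono exec.IfTrue nat_add_left_cancel_le)

lemma runs_IfFalse:
  "eval_expr e \<sigma> = Leaf \<Longrightarrow> expr_cost e \<sigma> \<le> a \<Longrightarrow> runs d \<sigma> \<sigma>' b \<Longrightarrow> runs (If e c d) \<sigma> \<sigma>' (1 + a + b)"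
  unfolding runs_def by (meson add_le_mono exec.IfFalse nat_add_left_cancel_le)

lemma runs_WhileFalse:
  "eval_expr e \<sigma> = Leaf \<Longrightarrow> expr_cost e \<sigma> \<le> a \<Longrightarrow> runs (While e c) \<sigma> \<sigma> (1 + a)"
  unfolding runs_def using exec.WhileFalse by fastforce

lemma runs_WhileTrue:
  "eval_expr e \<sigma> \<noteq> Leaf \<Longrightarrow> expr_cost e \<sigma> \<le> a \<Longrightarrow> runs c \<sigma> \<sigma>' b \<Longrightarrow> runs (While e c) \<sigma>' \<sigma>'' d
   \<Longrightarrow> runs (While e c) \<sigma> \<sigma>'' (1 + a + b + d)"
  unfolding runs_def by (meson add_le_mono exec.WhileTrue nat_add_left_cancel_le)

lemma runs_mono: "runs c \<sigma> \<sigma>' a \<Longrightarrow> a \<le> b \<Longrightarrow> runs c \<sigma> \<sigma>' b"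
  unfolding runs_def by (meson order_trans)

lemma runs_frame: "runs c \<sigma> \<sigma>' a \<Longrightarrow> y \<notin> com_vars c \<Longrightarrow> runs c (\<sigma>(y := v)) (\<sigma>'(y := v)) a"
  unfolding runs_def by (meson exec_frame)

text \<open>Stronger than \<open>polytime_on\<close> in two ways. There is no restricted domain, so
  closure lemmas carry no side conditions about it. All work variables are \<open>Leaf\<close> again
  at the end, so that programs compose by \<open>Seq\<close> alone.\<close>

definition ptime :: "('a \<Rightarrow> tree) \<Rightarrow> ('b \<Rightarrow> tree) \<Rightarrow> ('a \<Rightarrow> 'b) \<Rightarrow> bool" where
  "ptime ea eb f \<longleftrightarrow> (\<exists>c p. \<forall>x.
     runs c (init_state (ea x)) (init_state (eb (f x))) (poly p (tsize (ea x))))"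

lemma ptime_polytime_on: "ptime ea eb f \<Longrightarrow> polytime_on ea eb D f"
  unfolding ptime_def polytime_on_def runs_def
  by (metis (no_types, lifting) init_state_def)

lemma ptimeI:
  assumes "poly_bounded g"
    and "\<And>x. runs c (init_state (ea x)) (init_state (eb (f x))) (g (tsize (ea x)))"
  shows "ptime ea eb f"
  using assms unfolding ptime_def poly_bounded_def by (metis runs_mono)

text \<open>Adding the identity polynomial pays for the input already in the store, so one
  polynomial bounds both the running time and the size of the output.\<close>

lemma ptimeE:
  assumes "ptime ea eb f"
  obtains c p where
    "\<And>x. runs c (init_state (ea x)) (init_state (eb (f x))) (poly p (tsize (ea x)))"
    "\<And>x. tsize (eb (f x)) \<le> poly p (tsize (ea x))"
proof -
  obtain c p where r:
    "\<And>x. runs c (init_state (ea x)) (init_state (eb (f x))) (poly p (tsize (ea x)))"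
    using assms unfolding ptime_def by blast
  have "tsize (eb (f x)) \<le> tsize (ea x) + poly p (tsize (ea x))" for x
  proof -
    obtain n where n: "n \<le> poly p (tsize (ea x))"
      "exec c (init_state (ea x)) n (init_state (eb (f x)))"
      using r[of x] unfolding runs_def by blast
    have "\<forall>y. tsize (init_state (ea x) y) \<le> tsize (ea x)"
      using tsize_pos[of "ea x"] by (auto simp: init_state_def)
    from exec_size[OF n(2) this] have "tsize (init_state (eb (f x)) 0) \<le> tsize (ea x) + n" by blast
    then show ?thesis using n(1) by (simp add: init_state_def)
  qed
  then have "tsize (eb (f x)) \<le> poly ([:0, 1:] + p) (tsize (ea x))" for x by simp
  moreover have
    "runs c (init_state (ea x)) (init_state (eb (f x))) (poly ([:0, 1:] + p) (tsize (ea x)))" for x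
    by (rule runs_mono[OF r]) simp
  ultimately show thesis using that by blast
qed

lemma init_state_upd_0 [simp]: "(init_state d)(0 := e) = init_state e"
  by (auto simp: init_state_def)

lemma init_state_0 [simp]: "init_state d 0 = d"
  by (simp add: init_state_def)

lemma init_state_upd_Leaf [simp]: "0 < y \<Longrightarrow> (init_state d)(y := Leaf) = init_state d"
  by (auto simp: init_state_def)

lemma expr_cost_bounded:
  "\<exists>p. \<forall>d. expr_cost e (init_state d) \<le> poly p (tsize d)"
proof -
  \<comment> \<open>The induction carries the size of the value along, because every operation is
    also charged for its result.\<close>
  have size: "\<exists>p. \<forall>d. expr_cost e (init_state d) \<le> poly p (tsize d)
     \<and> tsize (eval_expr e (init_state d)) \<le> poly p (tsize d)" for e
  proof (induction e)
    case (Var x)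
    show ?case
      using tsize_pos
      by (intro exI[of _ "[:0, 1:]"]) (auto simp: init_state_def Suc_le_eq)
  next
    case Empty
    show ?case by (intro exI[of _ "[:1:]"]) simp
  next
    case (Cons e1 e2)
    then obtain p q where
      p: "\<And>d. expr_cost e1 (init_state d) \<le> poly p (tsize d)"
         "\<And>d. tsize (eval_expr e1 (init_state d)) \<le> poly p (tsize d)" and
      q: "\<And>d. expr_cost e2 (init_state d) \<le> poly q (tsize d)"
         "\<And>d. tsize (eval_expr e2 (init_state d)) \<le> poly q (tsize d)" by blast
    have "expr_cost (Cons e1 e2) (init_state d) \<le> poly (1 + (p + p) + (q + q)) (tsize d)" for d
      using p[of d] q[of d] by simp
    moreover have "tsize (eval_expr (Cons e1 e2) (init_state d)) \<le> poly (1 + (p + p) + (q + q)) (tsize d)"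
      for d
      using p[of d] q[of d] by simp
    ultimately show ?case by blast
  next
    case (Hd e)
    then obtain p where
      p: "\<And>d. expr_cost e (init_state d) \<le> poly p (tsize d)"
         "\<And>d. tsize (eval_expr e (init_state d)) \<le> poly p (tsize d)" by blast
    have *: "tsize (eval_expr (Hd e) (init_state d)) \<le> tsize (eval_expr e (init_state d))" for d
      by (cases "eval_expr e (init_state d)") auto
    have "expr_cost (Hd e) (init_state d) \<le> poly (p + p) (tsize d)" for d
      using p[of d] *[of d] by simp
    moreover have "tsize (eval_expr (Hd e) (init_state d)) \<le> poly (p + p) (tsize d)" for d
      using p[of d] *[of d] by simp
    ultimately show ?case by blast
  next
    case (Tl e)
    then obtain p where
      p: "\<And>d. expr_cost e (init_state d) \<le> poly p (tsize d)"
         "\<And>d. tsize (eval_expr e (init_state d)) \<le> poly p (tsize d)" by blast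
    have *: "tsize (eval_expr (Tl e) (init_state d)) \<le> tsize (eval_expr e (init_state d))" for d
      by (cases "eval_expr e (init_state d)") auto
    have "expr_cost (Tl e) (init_state d) \<le> poly (p + p) (tsize d)" for d
      using p[of d] *[of d] by simp
    moreover have "tsize (eval_expr (Tl e) (init_state d)) \<le> poly (p + p) (tsize d)" for d
      using p[of d] *[of d] by simp
    ultimately show ?case by blast
  qed
  then show ?thesis by blast
qed

lemma ptime_expr:
  assumes "\<And>x. eval_expr e (init_state (ea x)) = eb (f x)"
  shows "ptime ea eb f"
proof -
  obtain p where p: "\<And>d. expr_cost e (init_state d) \<le> poly p (tsize d)"
    using expr_cost_bounded by blast
  show ?thesis
  proof (rule ptimeI[where c = "Assign 0 e" and g = "\<lambda>n. 1 + poly p n"])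
    show "runs (Assign 0 e) (init_state (ea x)) (init_state (eb (f x))) (1 + poly p (tsize (ea x)))"
      for x
      by (rule runs_Assign[OF p]) (simp only: assms init_state_upd_0)
  qed (intro poly_bounded_intros)
qed

lemma ptime_compose:
  assumes "ptime eb ec g" "ptime ea eb f"
  shows "ptime ea ec (\<lambda>x. g (f x))"
proof -
  obtain c p where c:
    "\<And>x. runs c (init_state (ea x)) (init_state (eb (f x))) (poly p (tsize (ea x)))"
    "\<And>x. tsize (eb (f x)) \<le> poly p (tsize (ea x))"
    by (rule ptimeE[OF assms(2)]) (rule that)
  obtain d q where d:
    "\<And>x. runs d (init_state (eb x)) (init_state (ec (g x))) (poly q (tsize (eb x)))"
    by (rule ptimeE[OF assms(1)]) (rule that)
  show ?thesis
  proof (rule ptimeI[where c = "Seq c d" and g = "\<lambda>n. 1 + poly p n + poly q (poly p n)"])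
    show "runs (Seq c d) (init_state (ea x)) (init_state (ec (g (f x))))
      (1 + poly p (tsize (ea x)) + poly q (poly p (tsize (ea x))))" for x
      by (rule runs_Seq[OF c(1)[of x] runs_mono[OF d[of "f x"] poly_nat_mono[OF c(2)[of x]]]])
  qed (intro poly_bounded_intros)
qed

lemma fresh_var: "finite A \<Longrightarrow> \<exists>y::nat. 0 < y \<and> y \<notin> A"
  by (metis (no_types, lifting) ex_new_if_finite finite_insert infinite_UNIV_nat insertCI not_gr_zero)

text \<open>Both programs work in variable 0. A fresh \<open>y\<close> preserves the input for the
  second one and a fresh \<open>z\<close> the first result; clearing both restores an initial
  state.\<close>

lemma ptime_Pair:
  assumes "ptime ea eb f" "ptime ea ec g"
  shows "ptime ea (enc_pair eb ec) (\<lambda>x. (f x, g x))"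
proof -
  obtain c p where c:
    "\<And>x. runs c (init_state (ea x)) (init_state (eb (f x))) (poly p (tsize (ea x)))"
    "\<And>x. tsize (eb (f x)) \<le> poly p (tsize (ea x))"
    by (rule ptimeE[OF assms(1)]) (rule that)
  obtain d q where d:
    "\<And>x. runs d (init_state (ea x)) (init_state (ec (g x))) (poly q (tsize (ea x)))"
    "\<And>x. tsize (ec (g x)) \<le> poly q (tsize (ea x))"
    by (rule ptimeE[OF assms(2)]) (rule that)
  obtain y where y: "0 < y" "y \<notin> com_vars c \<union> com_vars d"
    using fresh_var finite_com_vars by (metis finite_UnI)
  obtain z where z: "0 < z" "z \<notin> insert y (com_vars c \<union> com_vars d)"
    using fresh_var finite_com_vars by (metis finite_UnI finite_insert)
  let ?C = "Seq (Assign y (Var 0)) (Seq c (Seq (Assign z (Var 0)) (Seq (Assign 0 (Var y))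
    (Seq d (Seq (Assign 0 (Cons (Var z) (Var 0))) (Seq (Assign y Empty) (Assign z Empty)))))))"
  let ?g = "\<lambda>n. 1 + (1 + n) + (1 + poly p n + (1 + (1 + poly p n) + (1 + (1 + n) + (1 + poly q n +
     (1 + (1 + (1 + 2 * (poly p n + poly q n))) + (1 + (1 + 1) + (1 + 1)))))))"
  show ?thesis
  proof (rule ptimeI[where c = ?C and g = ?g])
    fix x
    let ?d = "ea x" and ?a = "eb (f x)" and ?b = "ec (g x)"
    have yz: "y \<noteq> z" "y \<noteq> 0" "z \<noteq> 0" using y z by auto
    have [simp]: "init_state e u = Leaf" if "u \<noteq> 0" for e u using that by (simp add: init_state_def)
    show "runs ?C (init_state ?d) (init_state (enc_pair eb ec (f x, g x))) (?g (tsize ?d))"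
    proof (intro runs_Seq)
      show "runs (Assign y (Var 0)) (init_state ?d) ((init_state ?d)(y := ?d)) (1 + tsize ?d)"
        by (rule runs_Assign) auto
      show "runs c ((init_state ?d)(y := ?d)) ((init_state ?a)(y := ?d)) (poly p (tsize ?d))"
        using y by (intro runs_frame c) auto
      show "runs (Assign z (Var 0)) ((init_state ?a)(y := ?d)) ((init_state ?a)(y := ?d, z := ?a))
        (1 + poly p (tsize ?d))"
        using yz c(2)[of x] by (intro runs_Assign) auto
      show "runs (Assign 0 (Var y)) ((init_state ?a)(y := ?d, z := ?a))
         ((init_state ?d)(y := ?d, z := ?a)) (1 + tsize ?d)"
        using yz by (intro runs_Assign) (auto simp: init_state_def)
      show "runs d ((init_state ?d)(y := ?d, z := ?a)) ((init_state ?b)(y := ?d, z := ?a))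
         (poly q (tsize ?d))"
        using y z by (intro runs_frame d) auto
      show "runs (Assign 0 (Cons (Var z) (Var 0))) ((init_state ?b)(y := ?d, z := ?a))
         ((init_state (Node ?a ?b))(y := ?d, z := ?a))
         (1 + (1 + 2 * (poly p (tsize ?d) + poly q (tsize ?d))))"
        using yz c(2)[of x] d(2)[of x] by (intro runs_Assign) (auto simp: init_state_def)
      show "runs (Assign y Empty) ((init_state (Node ?a ?b))(y := ?d, z := ?a))
         ((init_state (Node ?a ?b))(z := ?a)) (1 + 1)"
        using yz by (intro runs_Assign) (auto simp: init_state_def)
      show "runs (Assign z Empty) ((init_state (Node ?a ?b))(z := ?a))
         (init_state (enc_pair eb ec (f x, g x))) (1 + 1)"
        using yz by (intro runs_Assign) (auto simp: init_state_def enc_pair_def)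
    qed
  qed (intro poly_bounded_intros)
qed

lemma enc_bool_simps [simp]: "enc_bool True = Node Leaf Leaf" "enc_bool False = Leaf"
  by (auto simp: enc_bool_def)

lemma ptime_if:
  assumes "ptime ea enc_bool b" "ptime ea eb f" "ptime ea eb g"
  shows "ptime ea eb (\<lambda>x. if b x then f x else g x)"
proof -
  obtain c p where c:
    "\<And>x. runs c (init_state (ea x)) (init_state (enc_bool (b x))) (poly p (tsize (ea x)))"
    by (rule ptimeE[OF assms(1)]) (rule that)
  obtain d q where d:
    "\<And>x. runs d (init_state (ea x)) (init_state (eb (f x))) (poly q (tsize (ea x)))"
    by (rule ptimeE[OF assms(2)]) (rule that)
  obtain e r where e:
    "\<And>x. runs e (init_state (ea x)) (init_state (eb (g x))) (poly r (tsize (ea x)))"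
    by (rule ptimeE[OF assms(3)]) (rule that)
  obtain y where y: "0 < y" "y \<notin> com_vars c"
    using fresh_var finite_com_vars by metis
  let ?R = "\<lambda>d. Seq (Assign 0 (Var y)) (Seq (Assign y Empty) d)"
  let ?C = "Seq (Assign y (Var 0)) (Seq c (If (Var 0) (?R d) (?R e)))"
  \<comment> \<open>The 3 is the size of \<open>enc_bool True\<close>, the most that evaluating the
    test can cost. The bounds of the two branches are added because either may be taken.\<close>
  let ?g = "\<lambda>n. 1 + (1 + n) + (1 + poly p n + (1 + 3 + (1 + (1 + n) + (1 + (1 + 1) +
     (poly q n + poly r n)))))"
  show ?thesis
  proof (rule ptimeI[where c = ?C and g = ?g])
    fix x
    let ?d = "ea x" and ?b = "enc_bool (b x)" and ?h = "if b x then f x else g x"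
    let ?n = "tsize ?d"
    have R: "runs (?R k) ((init_state ?b)(y := ?d)) (init_state (eb ?h))
        (1 + (1 + ?n) + (1 + (1 + 1) + (poly q ?n + poly r ?n)))"
      if k: "runs k (init_state ?d) (init_state (eb ?h)) m" "m \<le> poly q ?n + poly r ?n" for k m
    proof (intro runs_Seq)
      show "runs (Assign 0 (Var y)) ((init_state ?b)(y := ?d)) ((init_state ?d)(y := ?d)) (1 + ?n)"
        using y by (intro runs_Assign) (auto simp: init_state_def)
      show "runs (Assign y Empty) ((init_state ?d)(y := ?d)) (init_state ?d) (1 + 1)"
        using y by (intro runs_Assign) (auto simp: init_state_def)
      show "runs k (init_state ?d) (init_state (eb ?h)) (poly q ?n + poly r ?n)"
        by (rule runs_mono[OF k])
    qed
    show "runs ?C (init_state ?d) (init_state (eb ?h)) (?g ?n)"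
    proof (intro runs_Seq)
      show "runs (Assign y (Var 0)) (init_state ?d) ((init_state ?d)(y := ?d)) (1 + ?n)"
        by (rule runs_Assign) auto
      show "runs c ((init_state ?d)(y := ?d)) ((init_state ?b)(y := ?d)) (poly p ?n)"
        using y by (intro runs_frame c) auto
      show "runs (If (Var 0) (?R d) (?R e)) ((init_state ?b)(y := ?d)) (init_state (eb ?h))
        (1 + 3 + (1 + (1 + ?n) + (1 + (1 + 1) + (poly q ?n + poly r ?n))))"
      proof (cases "b x")
        case True
        have "runs d (init_state ?d) (init_state (eb ?h)) (poly q ?n)" using d[of x] True by simp
        note R[OF this le_add1]
        then show ?thesis using y True by (intro runs_IfTrue) simp_all
      next
        case False
        have "runs e (init_state ?d) (init_state (eb ?h)) (poly r ?n)" using e[of x] False by simp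
        note R[OF this le_add2]
        then show ?thesis using y False by (intro runs_IfFalse) simp_all
      qed
    qed
  qed (intro poly_bounded_intros)
qed

lemma length_le_tsize_enc_list: "length xs \<le> tsize (enc_list ea xs)"
  by (induction xs) auto

text \<open>Variable \<open>l\<close> holds the rest of the list, \<open>v\<close> the parameter and
  0 the accumulator. \<open>W\<close>, \<open>M\<close> and \<open>B\<close> bound the sizes of the
  parameter, the list and the accumulator; \<open>B\<close> holds throughout because a step adds at
  most \<open>D\<close>. \<open>K\<close> is the cost of one round, with a generous factor 7 for
  building the argument of \<open>c\<close>.\<close>

lemma foldl_loop:
  fixes ea :: "'a \<Rightarrow> tree" and eb :: "'b \<Rightarrow> tree"
  assumes c: "\<And>x b. runs c (init_state (Node w (Node (ea x) (eb b)))) (init_state (eb (F b x)))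
      (poly p (2 + tsize w + tsize (ea x) + tsize (eb b)))"
    and bound: "\<And>b x. tsize (ea x) \<le> M \<Longrightarrow> tsize (eb (F b x)) \<le> tsize (eb b) + D"
    and vl: "0 < v" "0 < l" "v \<noteq> l" "v \<notin> com_vars c" "l \<notin> com_vars c"
    and K: "K = 1 + M + (1 + (1 + (7 * (2 + W + M + B))) + (1 + (1 + 2 * M) + poly p (2 + W + M + B)))"
    and W: "tsize w \<le> W"
  shows "tsize (enc_list ea xs) \<le> M \<Longrightarrow> tsize (eb b) + length xs * D \<le> B \<Longrightarrow>
    runs (While (Var l) (Seq (Assign 0 (Cons (Var v) (Cons (Hd (Var l)) (Var 0))))
                        (Seq (Assign l (Tl (Var l))) c)))
      ((init_state (eb b))(v := w, l := enc_list ea xs))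
      ((init_state (eb (foldl F b xs)))(v := w)) (2 + length xs * K)"
proof (induction xs arbitrary: b)
  case Nil
  have eq: "((init_state (eb b))(v := w, l := enc_list ea [])) = (init_state (eb b))(v := w)"
    using vl by (auto simp: init_state_def)
  have "eval_expr (Var l) ((init_state (eb b))(v := w)) = Leaf"
    using vl by (simp add: init_state_def)
  then show ?case
    unfolding eq foldl.simps list.size mult_0 by (intro runs_mono[OF runs_WhileFalse[OF _ order_refl]]) auto
next
  case (Cons x xs)
  let ?W = "While (Var l) (Seq (Assign 0 (Cons (Var v) (Cons (Hd (Var l)) (Var 0))))
                        (Seq (Assign l (Tl (Var l))) c))"
  let ?N = "Node w (Node (ea x) (eb b))"
  have M: "tsize (ea x) \<le> M" "tsize (enc_list ea xs) \<le> M" "tsize (enc_list ea (x # xs)) \<le> M"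
    using Cons.prems(1) by auto
  have "tsize (eb (F b x)) \<le> tsize (eb b) + D" by (rule bound[OF M(1)])
  then have "tsize (eb (F b x)) + length xs * D \<le> B"
    using Cons.prems(2) by simp
  note IH = Cons.IH[OF M(2) this]
  have B: "tsize (eb b) \<le> B" using Cons.prems(2) by simp
  have "runs ?W ((init_state (eb b))(v := w, l := enc_list ea (x # xs)))
     ((init_state (eb (foldl F (F b x) xs)))(v := w))
     (1 + M + (1 + (1 + (7 * (2 + W + M + B))) + (1 + (1 + 2 * M) + poly p (2 + W + M + B)))
      + (2 + length xs * K))"
  proof (rule runs_WhileTrue[OF _ _ _ IH])
    show "runs (Seq (Assign 0 (Cons (Var v) (Cons (Hd (Var l)) (Var 0)))) (Seq (Assign l (Tl (Var l))) c))
       ((init_state (eb b))(v := w, l := enc_list ea (x # xs)))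
       ((init_state (eb (F b x)))(v := w, l := enc_list ea xs))
       (1 + (1 + (7 * (2 + W + M + B))) + (1 + (1 + 2 * M) + poly p (2 + W + M + B)))"
    proof (intro runs_Seq)
      show "runs (Assign 0 (Cons (Var v) (Cons (Hd (Var l)) (Var 0))))
         ((init_state (eb b))(v := w, l := enc_list ea (x # xs)))
         ((init_state ?N)(v := w, l := enc_list ea (x # xs))) (1 + (7 * (2 + W + M + B)))"
        using vl M B W by (intro runs_Assign) (auto simp: init_state_def)
      show "runs (Assign l (Tl (Var l))) ((init_state ?N)(v := w, l := enc_list ea (x # xs)))
         ((init_state ?N)(v := w, l := enc_list ea xs)) (1 + 2 * M)"
        using vl M by (intro runs_Assign) (auto simp: init_state_def)
      show "runs c ((init_state ?N)(v := w, l := enc_list ea xs))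
         ((init_state (eb (F b x)))(v := w, l := enc_list ea xs)) (poly p (2 + W + M + B))"
        using vl
        by (intro runs_frame runs_mono[OF c] poly_nat_mono) (use M B W in auto)
    qed
  qed (use vl M in auto)
  then show ?case unfolding foldl.simps by (rule runs_mono) (simp add: K algebra_simps)
qed

text \<open>A step that doubled the accumulator would make the fold exponential. The growth allowed
  per step is therefore additive and depends only on the parameter and the element, not on the
  accumulator.\<close>

lemma ptime_foldl_aux:
  fixes F :: "'c \<Rightarrow> 'b \<Rightarrow> 'a \<Rightarrow> 'b"
  assumes "ptime (enc_pair ec (enc_pair ea eb)) eb (\<lambda>w. F (fst w) (snd (snd w)) (fst (snd w)))"
    and bound: "poly_bounded h"
      "\<And>c b x s. tsize (ec c) \<le> s \<Longrightarrow> tsize (ea x) \<le> s \<Longrightarrow> tsize (eb (F c b x)) \<le> tsize (eb b) + h s"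
  shows "ptime (enc_pair ec (enc_pair (enc_list ea) eb)) eb
    (\<lambda>w. foldl (F (fst w)) (snd (snd w)) (fst (snd w)))"
proof -
  obtain c p where c: "\<And>u x b. runs c (init_state (Node (ec u) (Node (ea x) (eb b))))
      (init_state (eb (F u b x))) (poly p (2 + tsize (ec u) + tsize (ea x) + tsize (eb b)))"
  proof -
    obtain c p where c: "\<And>w. runs c (init_state (enc_pair ec (enc_pair ea eb) w))
      (init_state (eb (F (fst w) (snd (snd w)) (fst (snd w)))))
      (poly p (tsize (enc_pair ec (enc_pair ea eb) w)))"
      by (rule ptimeE[OF assms(1)]) (rule that)
    show thesis
    proof (rule that)
      fix u x b
      show "runs c (init_state (Node (ec u) (Node (ea x) (eb b))))
        (init_state (eb (F u b x))) (poly p (2 + tsize (ec u) + tsize (ea x) + tsize (eb b)))"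
        using c[of "(u, x, b)"] by (simp add: enc_pair_def add.assoc)
    qed
  qed
  obtain v where v: "0 < v" "v \<notin> com_vars c"
    using fresh_var finite_com_vars by metis
  obtain l where l: "0 < l" "l \<notin> insert v (com_vars c)"
    using fresh_var finite_com_vars by (metis finite_insert)
  obtain r where r: "\<And>n. h n \<le> poly r n" using bound(1) unfolding poly_bounded_def by blast
  let ?W = "While (Var l) (Seq (Assign 0 (Cons (Var v) (Cons (Hd (Var l)) (Var 0))))
                        (Seq (Assign l (Tl (Var l))) c))"
  let ?C = "Seq (Assign v (Hd (Var 0))) (Seq (Assign l (Hd (Tl (Var 0)))) (Seq (Assign 0 (Tl (Tl (Var 0))))
     (Seq ?W (Assign v Empty))))"
  \<comment> \<open>The accumulator starts with size at most n, and each of at most n steps adds at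
    most \<open>poly r n\<close>.\<close>
  let ?B = "\<lambda>n. n + n * poly r n"
  let ?K = "\<lambda>n. 1 + n + (1 + (1 + (7 * (2 + n + n + ?B n))) + (1 + (1 + 2 * n) + poly p (2 + n + n + ?B n)))"
  let ?g = "\<lambda>n. 1 + (1 + 2 * n) + (1 + (1 + 3 * n) + (1 + (1 + 3 * n) + (1 + (2 + n * ?K n) + (1 + 1))))"
  show ?thesis
  proof (rule ptimeI[where c = ?C and g = ?g])
    fix w :: "'c \<times> 'a list \<times> 'b"
    obtain u xs b where w: "w = (u, xs, b)" by (cases w)
    let ?w = "ec u" and ?xs = "enc_list ea xs" and ?b = "eb b"
    let ?d = "Node ?w (Node ?xs ?b)"
    let ?n = "tsize ?d"
    have vl: "v \<noteq> l" "v \<notin> com_vars c" "l \<notin> com_vars c" "0 < v" "0 < l" using v l by auto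
    have s: "tsize ?w \<le> ?n" "tsize ?xs \<le> ?n" "tsize ?b \<le> ?n" by auto
    have len: "length xs \<le> ?n" using length_le_tsize_enc_list[of xs ea] by simp
    have "runs ?C (init_state ?d) (init_state (eb (foldl (F u) b xs))) (?g ?n)"
    proof (intro runs_Seq)
      show "runs (Assign v (Hd (Var 0))) (init_state ?d) ((init_state ?d)(v := ?w)) (1 + 2 * ?n)"
        by (intro runs_Assign) auto
      show "runs (Assign l (Hd (Tl (Var 0)))) ((init_state ?d)(v := ?w))
         ((init_state ?d)(v := ?w, l := ?xs)) (1 + 3 * ?n)"
        using vl by (intro runs_Assign) auto
      show "runs (Assign 0 (Tl (Tl (Var 0)))) ((init_state ?d)(v := ?w, l := ?xs))
         ((init_state ?b)(v := ?w, l := ?xs)) (1 + 3 * ?n)"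
        using vl by (intro runs_Assign) (auto simp: init_state_def)
      show "runs ?W ((init_state ?b)(v := ?w, l := ?xs)) ((init_state (eb (foldl (F u) b xs)))(v := ?w))
         (2 + ?n * ?K ?n)"
      proof (rule runs_mono[OF foldl_loop[where M = ?n and D = "poly r ?n" and p = p and W = ?n
                  and B = "?B ?n" and c = c and w = ?w and ea = ea and eb = eb and F = "F u" and b = b
                  and xs = xs, OF c[of u] _ vl(4,5,1,2,3) refl s(1) s(2)]])
        show "tsize (eb (F u b x)) \<le> tsize (eb b) + poly r ?n" if "tsize (ea x) \<le> ?n" for b x
          using bound(2)[OF s(1) that, of b] r[of ?n] by linarith
        show "tsize (eb b) + length xs * poly r ?n \<le> ?B ?n"
          by (rule add_mono[OF s(3) mult_right_mono[OF len]]) simp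
        show "2 + length xs * ?K ?n \<le> 2 + ?n * ?K ?n"
          by (rule add_left_mono[OF mult_right_mono[OF len]]) simp
      qed
      show "runs (Assign v Empty) ((init_state (eb (foldl (F u) b xs)))(v := ?w))
        (init_state (eb (foldl (F u) b xs))) (1 + 1)"
        using vl by (intro runs_Assign) auto
    qed
    then show "runs ?C (init_state (enc_pair ec (enc_pair (enc_list ea) eb) w))
        (init_state (eb (foldl (F (fst w)) (snd (snd w)) (fst (snd w)))))
        (?g (tsize (enc_pair ec (enc_pair (enc_list ea) eb) w)))"
      by (simp only: w enc_pair_def fst_conv snd_conv)
  qed (intro poly_bounded_intros)
qed

subsection \<open>Polynomial-time functions on lists and numbers\<close>

fun tree_expr :: "tree \<Rightarrow> expr" where
  "tree_expr Leaf = Empty"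
| "tree_expr (Node l r) = Cons (tree_expr l) (tree_expr r)"

lemma eval_tree_expr: "eval_expr (tree_expr t) \<sigma> = t"
  by (induction t) auto

text \<open>Meant for basic functions whose encoded result is, after one test, an expression in the
  encoded input. Everything else comes from the closure properties.\<close>

lemma ptime_branch:
  assumes "\<And>x. c x \<longleftrightarrow> eval_expr e (init_state (ea x)) \<noteq> Leaf"
    and "\<And>x. c x \<Longrightarrow> eval_expr e1 (init_state (ea x)) = eb (f x)"
    and "\<And>x. \<not> c x \<Longrightarrow> eval_expr e2 (init_state (ea x)) = eb (f x)"
  shows "ptime ea eb f"
proof -
  obtain p where p: "\<And>d. expr_cost e (init_state d) \<le> poly p (tsize d)"
    using expr_cost_bounded by blast
  obtain q where q: "\<And>d. expr_cost e1 (init_state d) \<le> poly q (tsize d)"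
    using expr_cost_bounded by blast
  obtain r where r: "\<And>d. expr_cost e2 (init_state d) \<le> poly r (tsize d)"
    using expr_cost_bounded by blast
  show ?thesis
  proof (rule ptimeI[where c = "If e (Assign 0 e1) (Assign 0 e2)"
        and g = "\<lambda>n. 1 + poly p n + (1 + (poly q n + poly r n))"])
    fix x
    let ?n = "tsize (ea x)"
    show "runs (If e (Assign 0 e1) (Assign 0 e2)) (init_state (ea x)) (init_state (eb (f x)))
      (1 + poly p ?n + (1 + (poly q ?n + poly r ?n)))"
    proof (cases "c x")
      case True
      show ?thesis
      proof (rule runs_IfTrue[OF _ p])
        show "runs (Assign 0 e1) (init_state (ea x)) (init_state (eb (f x))) (1 + (poly q ?n + poly r ?n))"
          by (rule runs_Assign)
            (simp_all only: init_state_upd_0 assms(2)[OF True] trans_le_add1[OF q])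
      qed (use True assms(1)[of x] in simp)
    next
      case False
      show ?thesis
      proof (rule runs_IfFalse[OF _ p])
        show "runs (Assign 0 e2) (init_state (ea x)) (init_state (eb (f x))) (1 + (poly q ?n + poly r ?n))"
          by (rule runs_Assign)
            (simp_all only: init_state_upd_0 assms(3)[OF False] trans_le_add2[OF r])
      qed (use False assms(1)[of x] in simp)
    qed
  qed (intro poly_bounded_intros)
qed

lemma ptime_size:
  assumes "ptime ea eb f"
  obtains p where "\<And>x. tsize (eb (f x)) \<le> poly p (tsize (ea x))"
  by (rule ptimeE[OF assms]) (rule that)

lemma ptime_id: "ptime ea ea (\<lambda>x. x)"
  by (rule ptime_expr[of "Var 0"]) simp

lemma ptime_const: "ptime ea eb (\<lambda>x. c)"
  by (rule ptime_expr[of "tree_expr (eb c)"]) (simp add: eval_tree_expr)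

lemma ptime_fst: "ptime e (enc_pair ea eb) f \<Longrightarrow> ptime e ea (\<lambda>x. fst (f x))"
  by (erule ptime_compose[rotated]) (rule ptime_expr[of "Hd (Var 0)"], simp add: enc_pair_def)

lemma ptime_snd: "ptime e (enc_pair ea eb) f \<Longrightarrow> ptime e eb (\<lambda>x. snd (f x))"
  by (erule ptime_compose[rotated]) (rule ptime_expr[of "Tl (Var 0)"], simp add: enc_pair_def)

lemma ptime_compose2:
  assumes "ptime (enc_pair ea eb) ec (\<lambda>w. g (fst w) (snd w))" "ptime e ea u" "ptime e eb v"
  shows "ptime e ec (\<lambda>x. g (u x) (v x))"
  using ptime_compose[where g = "\<lambda>w. g (fst w) (snd w)" and f = "\<lambda>x. (u x, v x)",
      OF assms(1) ptime_Pair[OF assms(2,3)]]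
  by simp

lemma ptime_truth: "(\<And>x. b x \<longleftrightarrow> ea x \<noteq> Leaf) \<Longrightarrow> ptime ea enc_bool b"
  by (rule ptime_branch[where c = b and e = "Var 0" and ?e1.0 = "Cons Empty Empty" and ?e2.0 = Empty])
    (auto simp: enc_bool_def)

lemma ptime_conj:
  assumes "ptime e enc_bool a" "ptime e enc_bool b"
  shows "ptime e enc_bool (\<lambda>x. a x \<and> b x)"
proof -
  have "(\<lambda>x. if a x then b x else False) = (\<lambda>x. a x \<and> b x)" by auto
  with ptime_if[OF assms ptime_const[of _ _ False]] show ?thesis by simp
qed

lemma ptime_disj:
  assumes "ptime e enc_bool a" "ptime e enc_bool b"
  shows "ptime e enc_bool (\<lambda>x. a x \<or> b x)"
proof -
  have "(\<lambda>x. if a x then True else b x) = (\<lambda>x. a x \<or> b x)" by auto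
  with ptime_if[OF assms(1) ptime_const[of _ _ True] assms(2)] show ?thesis by simp
qed

lemma ptime_not:
  assumes "ptime e enc_bool a"
  shows "ptime e enc_bool (\<lambda>x. \<not> a x)"
proof -
  have "(\<lambda>x. if a x then False else True) = (\<lambda>x. \<not> a x)" by auto
  with ptime_if[OF assms ptime_const[of _ _ False] ptime_const[of _ _ True]] show ?thesis by simp
qed

lemma ptime_bool_eq:
  assumes "ptime e enc_bool a" "ptime e enc_bool b"
  shows "ptime e enc_bool (\<lambda>x. a x = b x)"
proof -
  have "(\<lambda>x. if a x then b x else \<not> b x) = (\<lambda>x. a x = b x)" by auto
  with ptime_if[OF assms ptime_not[OF assms(2)]] show ?thesis by simp
qed

lemma ptime_Cons:
  assumes "ptime e ea f" "ptime e (enc_list ea) g"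
  shows "ptime e (enc_list ea) (\<lambda>x. f x # g x)"
proof -
  have "ptime (enc_pair ea (enc_list ea)) (enc_list ea) (\<lambda>w. fst w # snd w)"
    by (rule ptime_expr[of "Var 0"]) (simp add: enc_pair_def)
  from ptime_compose[OF this ptime_Pair[OF assms]] show ?thesis by simp
qed

lemma ptime_tl: "ptime e (enc_list ea) f \<Longrightarrow> ptime e (enc_list ea) (\<lambda>x. tl (f x))"
proof (erule ptime_compose[rotated])
  have "right (enc_list ea xs) = enc_list ea (tl xs)" for xs by (cases xs) auto
  then show "ptime (enc_list ea) (enc_list ea) tl"
    by (intro ptime_expr[of "Tl (Var 0)"]) simp
qed

lemma ptime_take_1: "ptime e (enc_list ea) f \<Longrightarrow> ptime e (enc_list ea) (\<lambda>x. take 1 (f x))"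
proof (erule ptime_compose[rotated])
  show "ptime (enc_list ea) (enc_list ea) (take 1)"
  proof (rule ptime_branch[where c = "\<lambda>xs. xs \<noteq> []" and e = "Var 0"
        and ?e1.0 = "Cons (Hd (Var 0)) Empty" and ?e2.0 = Empty])
    show "xs \<noteq> [] \<longleftrightarrow> eval_expr (Var 0) (init_state (enc_list ea xs)) \<noteq> Leaf" for xs
      by (cases xs) auto
    show "eval_expr (Cons (Hd (Var 0)) Empty) (init_state (enc_list ea xs)) = enc_list ea (take 1 xs)"
      if "xs \<noteq> []" for xs using that by (cases xs) auto
  qed auto
qed

lemma ptime_foldl:
  assumes xs: "ptime e (enc_list ea) xs" and b: "ptime e eb b"
    and F: "ptime (enc_pair e (enc_pair ea eb)) eb (\<lambda>w. F (fst w) (snd (snd w)) (fst (snd w)))"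
    and h: "poly_bounded h"
      "\<And>x b y. tsize (eb (F x b y)) \<le> tsize (eb b) + h (tsize (e x) + tsize (ea y))"
  shows "ptime e eb (\<lambda>x. foldl (F x) (b x) (xs x))"
proof -
  obtain r where r: "\<And>n. h n \<le> poly r n" using h(1) unfolding poly_bounded_def by blast
  have "ptime (enc_pair e (enc_pair (enc_list ea) eb)) eb
    (\<lambda>w. foldl (F (fst w)) (snd (snd w)) (fst (snd w)))"
  \<comment> \<open>\<open>h\<close> is not assumed monotone, but its polynomial bound
    \<open>r\<close> is, so \<open>r\<close> takes its place; s + s accommodates the sum of the two
    sizes.\<close>
  proof (rule ptime_foldl_aux[OF F, where h = "\<lambda>s. poly r (s + s)"])
    fix x y b s
    assume "tsize (e x) \<le> s" "tsize (ea y) \<le> s"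
    then have "h (tsize (e x) + tsize (ea y)) \<le> poly r (s + s)"
      by (intro order_trans[OF r] poly_nat_mono add_mono)
    then show "tsize (eb (F x b y)) \<le> tsize (eb b) + poly r (s + s)"
      using h(2)[of x b y] by linarith
  qed (intro poly_bounded_intros)
  from ptime_compose[OF this ptime_Pair[OF ptime_id ptime_Pair[OF xs b]]] show ?thesis by simp
qed

lemma ptime_rev:
  assumes "ptime e (enc_list ea) xs"
  shows "ptime e (enc_list ea) (\<lambda>x. rev (xs x))"
proof -
  have eq: "foldl (\<lambda>b y. y # b) bs ys = rev ys @ bs" for ys bs :: "'b list"
    by (induction ys arbitrary: bs) auto
  have "ptime e (enc_list ea) (\<lambda>x. foldl (\<lambda>b y. y # b) [] (xs x))"
    by (rule ptime_foldl[where h = "\<lambda>n. 1 + n", OF assms ptime_const])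
      (rule ptime_Cons ptime_fst ptime_snd ptime_id poly_bounded_intros | simp)+
  then show ?thesis by (simp add: eq)
qed

lemma ptime_foldr:
  assumes xs: "ptime e (enc_list ea) xs" and b: "ptime e eb b"
    and F: "ptime (enc_pair e (enc_pair ea eb)) eb (\<lambda>w. F (fst w) (fst (snd w)) (snd (snd w)))"
    and h: "poly_bounded h"
      "\<And>x y b. tsize (eb (F x y b)) \<le> tsize (eb b) + h (tsize (e x) + tsize (ea y))"
  shows "ptime e eb (\<lambda>x. foldr (F x) (xs x) (b x))"
  unfolding foldr_conv_foldl
  by (rule ptime_foldl[where F = "\<lambda>x b y. F x y b" and h = h and ea = ea, OF ptime_rev[OF xs] b F h])

lemma ptime_map:
  assumes xs: "ptime e (enc_list ea) xs"
    and f: "ptime (enc_pair e ea) eb (\<lambda>w. f (fst w) (snd w))"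
  shows "ptime e (enc_list eb) (\<lambda>x. map (f x) (xs x))"
proof -
  obtain p where p: "\<And>w. tsize (eb (f (fst w) (snd w))) \<le> poly p (tsize (enc_pair e ea w))"
    by (rule ptime_size[OF f]) (rule that)
  have f': "ptime (enc_pair e (enc_pair ea ec)) eb (\<lambda>w. f (fst w) (fst (snd w)))" for ec :: "'d \<Rightarrow> tree"
    by (rule ptime_compose2[OF f]) (rule ptime_fst ptime_snd ptime_id)+
  have "ptime e (enc_list eb) (\<lambda>x. foldr (\<lambda>y b. f x y # b) (xs x) [])"
  proof (rule ptime_foldr[where h = "\<lambda>n. 1 + poly p (1 + n)", OF xs ptime_const])
    show "tsize (enc_list eb (f x y # b)) \<le>
      tsize (enc_list eb b) + (1 + poly p (1 + (tsize (e x) + tsize (ea y))))" for x y b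
      using p[of "(x, y)"] by (simp add: enc_pair_def)
  qed (rule ptime_Cons f' ptime_snd ptime_id poly_bounded_intros)+
  moreover have "foldr (\<lambda>y b. f x y # b) ys [] = map (f x) ys" for x ys
    by (induction ys) auto
  ultimately show ?thesis by simp
qed

lemma ptime_filter:
  assumes xs: "ptime e (enc_list ea) xs"
    and P: "ptime (enc_pair e ea) enc_bool (\<lambda>w. P (fst w) (snd w))"
  shows "ptime e (enc_list ea) (\<lambda>x. filter (P x) (xs x))"
proof -
  have P': "ptime (enc_pair e (enc_pair ea ec)) enc_bool (\<lambda>w. P (fst w) (fst (snd w)))"
    for ec :: "'d \<Rightarrow> tree"
    by (rule ptime_compose2[OF P]) (rule ptime_fst ptime_snd ptime_id)+
  have "ptime e (enc_list ea) (\<lambda>x. foldr (\<lambda>y b. if P x y then y # b else b) (xs x) [])"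
  proof (rule ptime_foldr[where h = "\<lambda>n. 1 + n", OF xs ptime_const])
    show "ptime (enc_pair e (enc_pair ea (enc_list ea))) (enc_list ea)
      (\<lambda>w. if P (fst w) (fst (snd w)) then fst (snd w) # snd (snd w) else snd (snd w))"
      by (rule ptime_if P' ptime_Cons ptime_fst ptime_snd ptime_id)+
  qed (rule poly_bounded_intros | simp)+
  moreover have "foldr (\<lambda>y b. if P x y then y # b else b) ys [] = filter (P x) ys" for x ys
    by (induction ys) auto
  ultimately show ?thesis by simp
qed

lemma ptime_append:
  assumes "ptime e (enc_list ea) xs" "ptime e (enc_list ea) ys"
  shows "ptime e (enc_list ea) (\<lambda>x. xs x @ ys x)"
proof -
  have "ptime e (enc_list ea) (\<lambda>x. foldr (#) (xs x) (ys x))"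
    by (rule ptime_foldr[where h = "\<lambda>n. 1 + n" and F = "\<lambda>x. (#)", OF assms])
      (rule ptime_Cons ptime_fst ptime_snd ptime_id poly_bounded_intros | simp)+
  moreover have "foldr (#) us vs = us @ vs" for us vs :: "'b list"
    by (induction us) auto
  ultimately show ?thesis by simp
qed

lemma tsize_append: "tsize (enc_list ea (xs @ ys)) < tsize (enc_list ea xs) + tsize (enc_list ea ys)"
  by (induction xs) auto

lemma ptime_concat:
  assumes "ptime e (enc_list (enc_list ea)) xs"
  shows "ptime e (enc_list ea) (\<lambda>x. concat (xs x))"
proof -
  have "ptime e (enc_list ea) (\<lambda>x. foldr (@) (xs x) [])"
  proof (rule ptime_foldr[where h = "\<lambda>n. n" and F = "\<lambda>x. (@)", OF assms ptime_const])
    show "tsize (enc_list ea (ys @ b)) \<le> tsize (enc_list ea b) + (tsize (e x) + tsize (enc_list ea ys))"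
      for x ys b using tsize_append[of ea ys b] by linarith
  qed (rule ptime_append ptime_fst ptime_snd ptime_id poly_bounded_intros)+
  then show ?thesis by (simp add: concat_conv_foldr)
qed

lemma ptime_list_ex:
  assumes xs: "ptime e (enc_list ea) xs"
    and P: "ptime (enc_pair e ea) enc_bool (\<lambda>w. P (fst w) (snd w))"
  shows "ptime e enc_bool (\<lambda>x. list_ex (P x) (xs x))"
proof -
  have "ptime e enc_bool (\<lambda>x. filter (P x) (xs x) \<noteq> [])"
  proof (rule ptime_compose[OF _ ptime_filter[OF xs P]])
    show "ptime (enc_list ea) enc_bool (\<lambda>xs. xs \<noteq> [])"
    proof (rule ptime_truth)
      show "xs \<noteq> [] \<longleftrightarrow> enc_list ea xs \<noteq> Leaf" for xs by (cases xs) auto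
    qed
  qed
  then show ?thesis by (simp add: list_ex_iff filter_empty_conv)
qed

section \<open>Binary arithmetic in polynomial time\<close>

lemma enc_nat_simps: "enc_nat 0 = Leaf" "0 < n \<Longrightarrow> enc_nat n = Node (enc_bool (odd n)) (enc_nat (n div 2))"
  by (simp_all add: enc_nat.simps)

lemma enc_nat_eq_Leaf: "enc_nat n = Leaf \<longleftrightarrow> n = 0"
  by (subst enc_nat.simps) simp

lemma enc_nat_double: "enc_nat (2 * n) = (if n = 0 then Leaf else Node Leaf (enc_nat n))"
  "enc_nat (Suc (2 * n)) = Node (Node Leaf Leaf) (enc_nat n)"
  by (simp_all add: enc_nat_simps)

lemma ptime_double: "ptime e enc_nat f \<Longrightarrow> ptime e enc_nat (\<lambda>x. 2 * f x)"
proof (erule ptime_compose[rotated])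
  show "ptime enc_nat enc_nat ((*) 2)"
    by (rule ptime_branch[where c = "\<lambda>n. n \<noteq> 0" and e = "Var 0" and ?e1.0 = "Cons Empty (Var 0)"
          and ?e2.0 = Empty]) (auto simp: enc_nat_eq_Leaf enc_nat_double enc_nat_simps)
qed

lemma ptime_Suc_double: "ptime e enc_nat f \<Longrightarrow> ptime e enc_nat (\<lambda>x. Suc (2 * f x))"
proof (erule ptime_compose[rotated])
  show "ptime enc_nat enc_nat (\<lambda>n. Suc (2 * n))"
    by (rule ptime_expr[of "Cons (Cons Empty Empty) (Var 0)"]) (auto simp: enc_nat_double)
qed

lemma ptime_div2: "ptime e enc_nat f \<Longrightarrow> ptime e enc_nat (\<lambda>x. f x div 2)"
proof (erule ptime_compose[rotated])
  have "right (enc_nat n) = enc_nat (n div 2)" for n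
    by (cases "n = 0") (auto simp: enc_nat_simps)
  then show "ptime enc_nat enc_nat (\<lambda>n. n div 2)"
    by (intro ptime_expr[of "Tl (Var 0)"]) simp
qed

lemma ptime_odd: "ptime e enc_nat f \<Longrightarrow> ptime e enc_bool (\<lambda>x. odd (f x))"
proof (erule ptime_compose[rotated])
  have "left (enc_nat n) = enc_bool (odd n)" for n
    by (cases "n = 0") (auto simp: enc_nat_simps)
  then show "ptime enc_nat enc_bool odd"
    by (intro ptime_expr[of "Hd (Var 0)"]) simp
qed

fun bits :: "nat \<Rightarrow> bool list" where
  "bits n = (if n = 0 then [] else odd n # bits (n div 2))"

declare bits.simps [simp del]

text \<open>Passing from a number to its bits changes nothing in the encoding, so folds over bit
  lists apply to numbers directly.\<close>

lemma enc_nat_bits: "enc_nat n = enc_list enc_bool (bits n)"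
proof (induction n rule: bits.induct)
  case (1 n)
  then show ?case by (subst enc_nat.simps, subst bits.simps) simp
qed

lemma ptime_bits: "ptime e enc_nat f \<Longrightarrow> ptime e (enc_list enc_bool) (\<lambda>x. bits (f x))"
  by (erule ptime_compose[rotated], rule ptime_expr[of "Var 0"]) (simp add: enc_nat_bits)

lemma less_two_power_length_bits: "n < 2 ^ length (bits n)"
proof (induction n rule: bits.induct)
  case (1 n)
  then show ?case by (cases "n = 0") (auto simp: bits.simps[of n])
qed

text \<open>A bit list with the most significant bit first, read on top of \<open>n\<close>.\<close>

definition push_bits :: "nat \<Rightarrow> bool list \<Rightarrow> nat" where
  "push_bits = foldl (\<lambda>n b. 2 * n + of_bool b)"

lemma push_bits_simps [simp]: "push_bits n [] = n" "push_bits n (b # bs) = push_bits (2 * n + of_bool b) bs"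
  by (simp_all add: push_bits_def)

lemma push_bits_append: "push_bits n (xs @ ys) = push_bits (push_bits n xs) ys"
  by (simp add: push_bits_def)

lemma push_rev_bits: "push_bits 0 (rev (bits n)) = n"
proof (induction n rule: bits.induct)
  case (1 n)
  then show ?case by (subst bits.simps) (auto simp: push_bits_append)
qed

lemma tsize_enc_nat_double_add:
  "tsize (enc_nat (2 * n + of_bool b)) \<le> tsize (enc_nat n) + (2 + 2 * of_bool b)"
  using tsize_pos[of "enc_nat n"] by (cases b) (auto simp: enc_nat_double)

text \<open>The bound has coefficient 1 on both sizes, as the growth condition for folds requires.
  The carry is there for the induction on halves: a digit costs 2 and a digit one costs 2 more, so a
  carry that becomes a new leading one costs 4.\<close>

lemma tsize_enc_nat_add_carry:
  "tsize (enc_nat (a + b + of_bool c)) < tsize (enc_nat a) + tsize (enc_nat b) + 4 * of_bool c"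
proof (induction "a + b" arbitrary: a b c rule: less_induct)
  case less
  have half: "tsize (enc_nat n) = tsize (enc_nat (n div 2)) + (2 * of_bool (0 < n) + 2 * of_bool (odd n))"
    for n by (cases "n = 0") (simp_all add: enc_nat_simps)
  show ?case
  proof (cases "a = 0 \<and> b = 0")
    case True
    then show ?thesis by (cases c) (simp_all add: enc_nat_simps)
  next
    case False
    \<comment> \<open>\<open>c'\<close> is the carry out of the lowest position and \<open>s\<close>
      the lowest digit of the sum.\<close>
    define c' where "c' = (odd a \<and> odd b \<or> odd a \<and> c \<or> odd b \<and> c)"
    define s where "s = odd (a + b + of_bool c)"
    have sum: "a + b + of_bool c = 2 * (a div 2 + b div 2 + of_bool c') + of_bool s"
      "2 * of_bool c' + of_bool s = of_bool (odd a) + of_bool (odd b) + (of_bool c :: nat)"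
      unfolding c'_def s_def by (cases "odd a"; cases "odd b"; cases c; auto elim!: evenE oddE)+
    have "a div 2 + b div 2 < a + b" using False by presburger
    from less[OF this, of c'] tsize_enc_nat_double_add[of "a div 2 + b div 2 + of_bool c'" s]
      half[of a] half[of b] sum(2) False
    show ?thesis unfolding sum(1) by (cases "a = 0"; cases "b = 0"; simp)
  qed
qed

lemmas ptime_intros = ptime_id ptime_Pair ptime_fst ptime_snd ptime_conj ptime_disj ptime_not
  ptime_bool_eq ptime_if ptime_Cons ptime_append ptime_tl ptime_take_1 ptime_rev ptime_concat
  ptime_map ptime_filter ptime_list_ex ptime_div2 ptime_odd ptime_bits ptime_Suc_double ptime_double

lemma tsize_enc_nat_div2: "tsize (enc_nat (n div 2)) \<le> tsize (enc_nat n)"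
  by (cases "n = 0") (auto simp: enc_nat_simps)

lemma tsize_enc_bool: "1 \<le> tsize (enc_bool b)" "tsize (enc_bool b) \<le> 3"
  by (cases b; simp)+

text \<open>Digits are read from the least significant one, so a later difference overrides earlier
  ones; the last component is the verdict on the digits read so far. The list element is ignored:
  the list is only a clock, at least as long as both numbers.\<close>

definition le_step :: "nat \<times> nat \<times> bool \<Rightarrow> bool \<Rightarrow> nat \<times> nat \<times> bool" where
  "le_step w _ = (fst w div 2, fst (snd w) div 2,
     if odd (fst w) = odd (fst (snd w)) then snd (snd w) else odd (fst (snd w)))"

lemma foldl_le_step:
  "a < 2 ^ length bs \<Longrightarrow> b < 2 ^ length bs \<Longrightarrow>
   snd (snd (foldl le_step (a, b, r) bs)) \<longleftrightarrow> a < b \<or> a = b \<and> r"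
proof (induction bs arbitrary: a b r)
  case Nil
  then show ?case by simp
next
  case (Cons x bs)
  have "a div 2 < 2 ^ length bs" "b div 2 < 2 ^ length bs" using Cons.prems by auto
  note IH = Cons.IH[OF this]
  have step: "le_step (a, b, r) x = (a div 2, b div 2, if odd a = odd b then r else odd b)"
    by (simp add: le_step_def)
  show ?case
    unfolding foldl.simps step IH by (cases r; simp; presburger)
qed

lemma ptime_nat_le:
  assumes "ptime e enc_nat f" "ptime e enc_nat g"
  shows "ptime e enc_bool (\<lambda>x. f x \<le> g x)"
proof -
  have "ptime e (enc_pair enc_nat (enc_pair enc_nat enc_bool))
      (\<lambda>x. foldl le_step (f x, g x, True) (bits (f x) @ bits (g x)))"
  proof (rule ptime_foldl[where F = "\<lambda>x. le_step" and h = "\<lambda>n. 2" and ea = enc_bool])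
    show "tsize (enc_pair enc_nat (enc_pair enc_nat enc_bool) (le_step w y))
      \<le> tsize (enc_pair enc_nat (enc_pair enc_nat enc_bool) w) + 2" for w y
      using tsize_enc_nat_div2[of "fst w"] tsize_enc_nat_div2[of "fst (snd w)"]
        tsize_enc_bool(1)[of "snd (snd w)"] tsize_enc_bool(2)[of "snd (snd (le_step w y))"]
      by (simp add: enc_pair_def le_step_def)
  qed (unfold le_step_def, (rule ptime_intros assms ptime_const poly_bounded_intros)+)
  from ptime_snd[OF ptime_snd[OF this]] show ?thesis
  proof (rule back_subst[of "ptime e enc_bool"])
    have *: "n < 2 ^ length (xs @ bits n @ ys)" for n xs ys
      using less_two_power_length_bits[of n]
      by (rule less_le_trans) (simp add: power_increasing)
    show "(\<lambda>x. snd (snd (foldl le_step (f x, g x, True) (bits (f x) @ bits (g x))))) = (\<lambda>x. f x \<le> g x)"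
    proof
      fix x
      show "snd (snd (foldl le_step (f x, g x, True) (bits (f x) @ bits (g x)))) = (f x \<le> g x)"
        using *[of "f x" "[]" "bits (g x)"] *[of "g x" "bits (f x)" "[]"]
        by (subst foldl_le_step) auto
    qed
  qed
qed

lemma ptime_nat_eq:
  assumes "ptime e enc_nat f" "ptime e enc_nat g"
  shows "ptime e enc_bool (\<lambda>x. f x = g x)"
  using ptime_conj[OF ptime_nat_le[OF assms] ptime_nat_le[OF assms(2,1)]]
  by (simp add: eq_iff)

text \<open>A ripple-carry adder, with the list again serving as a clock. The chain of equalities is
  the exclusive or of three bits. Digits are pushed in front, so the output has the most significant
  digit first, as \<open>push_bits\<close> expects, and the final carry is its leading
  digit.\<close>

definition add_step :: "nat \<times> nat \<times> bool \<times> bool list \<Rightarrow> bool \<Rightarrow> nat \<times> nat \<times> bool \<times> bool list" where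
  "add_step w _ = (fst w div 2, fst (snd w) div 2,
     odd (fst w) \<and> odd (fst (snd w)) \<or> odd (fst w) \<and> fst (snd (snd w)) \<or>
       odd (fst (snd w)) \<and> fst (snd (snd w)),
     (odd (fst w) = (odd (fst (snd w)) = fst (snd (snd w)))) # snd (snd (snd w)))"

lemma foldl_add_step:
  assumes "a < 2 ^ length bs" "b < 2 ^ length bs" "w = foldl add_step (a, b, c, out) bs"
  shows "push_bits (of_bool (fst (snd (snd w)))) (snd (snd (snd w))) = push_bits (a + b + of_bool c) out"
  using assms
proof (induction bs arbitrary: a b c out)
  case Nil
  then show ?case by simp
next
  case (Cons x bs)
  define c' where "c' = (odd a \<and> odd b \<or> odd a \<and> c \<or> odd b \<and> c)"
  define s where "s = (odd a = (odd b = c))"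
  have sum: "2 * (a div 2 + b div 2 + of_bool c') + of_bool s = a + b + of_bool c"
    unfolding c'_def s_def by (cases "odd a"; cases "odd b"; cases c; auto elim!: evenE oddE)
  have "a div 2 < 2 ^ length bs" "b div 2 < 2 ^ length bs" using Cons.prems by auto
  moreover have "add_step (a, b, c, out) x = (a div 2, b div 2, c', s # out)"
    by (simp add: add_step_def c'_def s_def)
  then have "w = foldl add_step (a div 2, b div 2, c', s # out) bs"
    using Cons.prems(3) by (simp only: foldl.simps)
  ultimately have "push_bits (of_bool (fst (snd (snd w)))) (snd (snd (snd w)))
    = push_bits (a div 2 + b div 2 + of_bool c') (s # out)"
    by (rule Cons.IH)
  then show ?case by (simp only: push_bits_simps sum)
qed

lemma ptime_of_bool: "ptime e enc_bool f \<Longrightarrow> ptime e enc_nat (\<lambda>x. of_bool (f x))"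
  unfolding of_bool_def by (rule ptime_if ptime_const | assumption)+

lemma ptime_push_bits:
  assumes "ptime e (enc_list enc_bool) bs" "ptime e enc_nat n"
  shows "ptime e enc_nat (\<lambda>x. push_bits (n x) (bs x))"
  unfolding push_bits_def
proof (rule ptime_foldl[where F = "\<lambda>x n b. 2 * n + of_bool b" and h = "\<lambda>n. 4", OF assms])
  have "(\<lambda>w. 2 * snd (snd w) + of_bool (fst (snd w)))
    = (\<lambda>w :: 'a \<times> bool \<times> nat. if fst (snd w) then Suc (2 * snd (snd w)) else 2 * snd (snd w))"
    by auto
  then show "ptime (enc_pair e (enc_pair enc_bool enc_nat)) enc_nat
    (\<lambda>w. 2 * snd (snd w) + of_bool (fst (snd w)))"
    by (simp only:) (rule ptime_intros)+
  show "tsize (enc_nat (2 * n + of_bool b)) \<le> tsize (enc_nat n) + 4" for n b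
    using tsize_enc_nat_double_add[of n b] by (cases b) simp_all
qed (rule poly_bounded_intros)

lemma ptime_add:
  assumes "ptime e enc_nat f" "ptime e enc_nat g"
  shows "ptime e enc_nat (\<lambda>x. f x + g x)"
proof -
  let ?eb = "enc_pair enc_nat (enc_pair enc_nat (enc_pair enc_bool (enc_list enc_bool)))"
  let ?w = "\<lambda>x. foldl add_step (f x, g x, False, []) (bits (f x) @ bits (g x))"
  have w: "ptime e ?eb ?w"
  proof (rule ptime_foldl[where F = "\<lambda>x. add_step" and h = "\<lambda>n. 6" and ea = enc_bool])
    show "tsize (?eb (add_step w y)) \<le> tsize (?eb w) + 6" for w y
      using tsize_enc_nat_div2[of "fst w"] tsize_enc_nat_div2[of "fst (snd w)"]
        tsize_enc_bool(1)[of "fst (snd (snd w))"] tsize_enc_bool(2)[of "fst (snd (snd (add_step w y)))"]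
        tsize_enc_bool(2)[of "hd (snd (snd (snd (add_step w y))))"]
      by (simp add: enc_pair_def add_step_def)
  qed (unfold add_step_def, (rule ptime_intros assms ptime_const poly_bounded_intros)+)
  have "ptime e enc_nat (\<lambda>x. push_bits (of_bool (fst (snd (snd (?w x))))) (snd (snd (snd (?w x)))))"
    by (rule ptime_push_bits ptime_of_bool ptime_snd ptime_fst w)+
  moreover have "push_bits (of_bool (fst (snd (snd (?w x))))) (snd (snd (snd (?w x)))) = f x + g x" for x
  proof -
    have *: "n < 2 ^ length (xs @ bits n @ ys)" for n xs ys
      using less_two_power_length_bits[of n]
      by (rule less_le_trans) (simp add: power_increasing)
    show ?thesis
      using foldl_add_step[OF _ _ refl, of "f x" "bits (f x) @ bits (g x)" "g x" False "[]"]
        *[of "f x" "[]"] *[of "g x" _ "[]"] by simp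
  qed
  ultimately show ?thesis by simp
qed

lemma tsize_enc_nat_add: "tsize (enc_nat (a + b)) < tsize (enc_nat a) + tsize (enc_nat b)"
  using tsize_enc_nat_add_carry[of a b False] by simp

text \<open>Shift-and-add multiplication as a Horner scheme: the accumulator is always
  \<open>m\<close> times the prefix read so far.\<close>

lemma foldl_mult:
  "foldl (\<lambda>n b. 2 * n + (if b then m else 0)) (k * m) bs = push_bits k bs * m"
proof (induction bs arbitrary: k)
  case (Cons b bs)
  have "2 * (k * m) + (if b then m else 0) = (2 * k + of_bool b) * m" by (simp add: algebra_simps)
  then show ?case using Cons.IH[of "2 * k + of_bool b"] by simp
qed simp

lemma ptime_mult:
  assumes "ptime e enc_nat f" "ptime e enc_nat g"
  shows "ptime e enc_nat (\<lambda>x. f x * g x)"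
proof -
  obtain p where p: "\<And>x. tsize (enc_nat (g x)) \<le> poly p (tsize (e x))"
    by (rule ptime_size[OF assms(2)]) (rule that)
  have "ptime e enc_nat
    (\<lambda>x. foldl (\<lambda>n b. 2 * n + (if b then g x else 0)) 0 (rev (bits (f x))))"
  proof (rule ptime_foldl[where F = "\<lambda>x n b. 2 * n + (if b then g x else 0)" and ea = enc_bool
        and h = "\<lambda>n. 2 + poly p n"])
    show "ptime (enc_pair e (enc_pair enc_bool enc_nat)) enc_nat
      (\<lambda>w. 2 * snd (snd w) + (if fst (snd w) then g (fst w) else 0))"
      by (rule ptime_add ptime_intros ptime_compose[OF assms(2)] ptime_const)+
    \<comment> \<open>Doubling adds at most 2 to the size, and adding the factor at most the size of
      \<open>g x\<close>, which is polynomial in the input and independent of the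
      accumulator.\<close>
    show "tsize (enc_nat (2 * n + (if b then g x else 0)))
       \<le> tsize (enc_nat n) + (2 + poly p (tsize (e x) + tsize (enc_bool b)))" for x n b
      using tsize_enc_nat_add[of "2 * n" "if b then g x else 0"]
        tsize_enc_nat_double_add[of n False] tsize_pos[of "enc_nat n"] p[of x]
        poly_nat_mono[of "tsize (e x)" "tsize (e x) + tsize (enc_bool b)" p]
      by (auto simp: enc_nat_simps)
  qed (rule ptime_intros assms ptime_const poly_bounded_intros)+
  moreover have "foldl (\<lambda>n b. 2 * n + (if b then m else 0)) 0 (rev (bits k)) = k * m" for k m
    using foldl_mult[of m 0 "rev (bits k)"] push_rev_bits[of k] by simp
  ultimately show ?thesis by simp
qed

lemma ptime_length:
  assumes "ptime e (enc_list ea) xs"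
  shows "ptime e enc_nat (\<lambda>x. length (xs x))"
proof -
  have "ptime e enc_nat (\<lambda>x. foldr (\<lambda>y n. n + 1) (xs x) 0)"
  proof (rule ptime_foldr[where F = "\<lambda>x y n. n + 1" and h = "\<lambda>n. 5", OF assms ptime_const])
    show "tsize (enc_nat (n + 1)) \<le> tsize (enc_nat n) + 5" for n
      using tsize_enc_nat_add[of n 1] by (simp add: enc_nat_simps)
  qed (rule ptime_add ptime_intros ptime_const poly_bounded_intros)+
  moreover have "foldr (\<lambda>y n. n + 1) ys 0 = length ys" for ys :: "'b list"
    by (induction ys) auto
  ultimately show ?thesis by simp
qed

section \<open>Comparing rationals by their numerators and denominators\<close>

lemma ptime_int_neg: "ptime e enc_int f \<Longrightarrow> ptime e enc_bool (\<lambda>x. f x < 0)"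
  by (erule ptime_compose[rotated]) (rule ptime_expr[of "Hd (Var 0)"], simp add: enc_int_def)

lemma ptime_nat_abs: "ptime e enc_int f \<Longrightarrow> ptime e enc_nat (\<lambda>x. nat \<bar>f x\<bar>)"
  by (erule ptime_compose[rotated]) (rule ptime_expr[of "Tl (Var 0)"], simp add: enc_int_def)

lemma ptime_quotient_of: "ptime e enc_rat f \<Longrightarrow> ptime e (enc_pair enc_int enc_int) (\<lambda>x. quotient_of (f x))"
  by (erule ptime_compose[rotated]) (rule ptime_expr[of "Var 0"], simp add: enc_rat_def)

text \<open>Denominators are positive, so that cross-multiplication leaves only the signs of the
  numerators to be distinguished.\<close>

lemma rat_le_iff:
  fixes q r :: rat
  defines "a \<equiv> fst (quotient_of q)" and "b \<equiv> snd (quotient_of q)"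
    and "c \<equiv> fst (quotient_of r)" and "d \<equiv> snd (quotient_of r)"
  shows "q \<le> r \<longleftrightarrow>
    (if a < 0 then if c < 0 then nat \<bar>c\<bar> * nat \<bar>b\<bar> \<le> nat \<bar>a\<bar> * nat \<bar>d\<bar> else True
     else if c < 0 then False else nat \<bar>a\<bar> * nat \<bar>d\<bar> \<le> nat \<bar>c\<bar> * nat \<bar>b\<bar>)"
proof -
  have pos: "0 < b" "0 < d" unfolding b_def d_def by (simp_all add: quotient_of_denom_pos')
  have q: "q \<le> r \<longleftrightarrow> a * d \<le> c * b"
    unfolding a_def b_def c_def d_def by (simp add: rat_less_eq_code case_prod_beta Let_def mult.commute)
  have signs: "a < 0 \<Longrightarrow> a * d < 0" "c < 0 \<Longrightarrow> c * b < 0" "\<not> a < 0 \<Longrightarrow> 0 \<le> a * d" "\<not> c < 0 \<Longrightarrow> 0 \<le> c * b"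
    using pos by (simp_all add: mult_neg_pos)
  have nat: "nat \<bar>x\<bar> * nat \<bar>y\<bar> \<le> nat \<bar>z\<bar> * nat \<bar>t\<bar> \<longleftrightarrow> \<bar>x * y\<bar> \<le> \<bar>z * t\<bar>" for x y z t :: int
    by (simp flip: nat_mult_distrib abs_mult add: nat_le_eq_zle)
  show ?thesis unfolding q nat using signs by (auto simp: abs_if)
qed

lemma ptime_rat_le:
  assumes "ptime e enc_rat f" "ptime e enc_rat g"
  shows "ptime e enc_bool (\<lambda>x. f x \<le> g x)"
  unfolding rat_le_iff
  by (rule ptime_if ptime_int_neg ptime_nat_le ptime_mult ptime_nat_abs ptime_fst ptime_snd
      ptime_quotient_of assms ptime_const)+

lemma ptime_rat_less:
  assumes "ptime e enc_rat f" "ptime e enc_rat g"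
  shows "ptime e enc_bool (\<lambda>x. f x < g x)"
  unfolding not_le[symmetric] by (intro ptime_not ptime_rat_le assms)

subsection \<open>The reduction\<close>

lemma ptime_rat_eq:
  assumes "ptime e enc_rat f" "ptime e enc_rat g"
  shows "ptime e enc_bool (\<lambda>x. f x = g x)"
  using ptime_conj[OF ptime_rat_le[OF assms] ptime_rat_le[OF assms(2,1)]]
  by (simp add: eq_iff)

abbreviation enc_interval :: "interval \<Rightarrow> tree" where
  "enc_interval \<equiv> enc_pair enc_rat enc_rat"

definition inside :: "interval \<Rightarrow> rat \<Rightarrow> bool" where
  "inside I p \<longleftrightarrow> fst I \<le> p \<and> p \<le> snd I"

text \<open>Entries with the left end of \<open>I\<close> disappear. Among unit intervals they equal
  \<open>I\<close>, so insertion also removes repetitions and the sorted list is strictly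
  increasing.\<close>

definition insert_left :: "interval list \<Rightarrow> interval \<Rightarrow> interval list" where
  "insert_left xs I = filter (\<lambda>J. fst J < fst I) xs @ I # filter (\<lambda>J. fst I < fst J) xs"

definition sort_left :: "interval list \<Rightarrow> interval list" where
  "sort_left = foldl insert_left []"

text \<open>Reading the intervals from left to right, the topmost one is dropped as soon as the interval
  below it and the new one cover it together.\<close>

definition push_hub :: "interval list \<Rightarrow> interval \<Rightarrow> interval list" where
  "push_hub G I = I # (if list_ex (\<lambda>J. fst I \<le> snd J) (tl G) then tl G else G)"

definition hubs :: "interval list \<Rightarrow> interval list" where
  "hubs = foldl push_hub []"

definition lex_less :: "interval \<Rightarrow> interval \<Rightarrow> bool" where
  "lex_less C D \<longleftrightarrow> fst C < fst D \<or> fst C = fst D \<and> snd C < snd D"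

text \<open>Replaces rational data by small natural numbers, injectively on the entries of the list.
  Repeated segments share their rank and hence their time label.\<close>

definition rank :: "interval list \<Rightarrow> interval \<Rightarrow> nat" where
  "rank xs C = length (filter (\<lambda>D. lex_less D C) xs)"

text \<open>The shift keeps \<open>0\<close> and \<open>1\<close> free for the source and the target.\<close>

definition ivertex :: "interval list \<Rightarrow> interval \<Rightarrow> nat" where
  "ivertex xs I = 2 * (rank xs I + 1)"

definition hvertex :: "interval list \<Rightarrow> interval \<Rightarrow> nat" where
  "hvertex xs I = Suc (2 * (rank xs I + 1))"

text \<open>The second run omits members of the first, so that no vertex is repeated.
  \<open>take 1\<close> selects a hub at the left end of the segment, and selects none only if no
  hub contains that point.\<close>

definition inner_path :: "interval list \<Rightarrow> interval \<Rightarrow> nat list" where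
  "inner_path xs C =
     map (ivertex xs) (filter (\<lambda>I. inside I (fst C)) (sort_left xs)) @
     map (hvertex xs) (take 1 (filter (\<lambda>J. inside J (fst C)) (hubs (sort_left xs)))) @
     map (ivertex xs) (filter (\<lambda>I. inside I (snd C) \<and> \<not> inside I (fst C)) (sort_left xs))"

text \<open>The consecutive pairs of the path, in reverse order; the fold form makes
  \<open>ptime_foldl\<close> applicable.\<close>

definition links :: "'v list \<Rightarrow> 'v \<Rightarrow> ('v \<times> 'v) list" where
  "links vs u = snd (foldl (\<lambda>w v. (v, (fst w, v) # snd w)) (u, []) vs)"

text \<open>Both orientations occur because temporal edges are symmetric, and labels are shifted by
  one because times start at 1.\<close>

definition layer :: "interval list \<Rightarrow> interval list \<Rightarrow> interval \<Rightarrow> nat tedge list" where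
  "layer \<Gamma> xs C = concat (map (\<lambda>w. [(fst w, snd w, rank \<Gamma> C + 1), (snd w, fst w, rank \<Gamma> C + 1)])
     (links (inner_path xs C @ [1]) 0))"

definition reduction :: "interval list \<times> interval list \<Rightarrow> ts_instance" where
  "reduction x = \<lparr>
     vertices = 0 # 1 # map (ivertex (snd x)) (sort_left (snd x)) @
       map (hvertex (snd x)) (hubs (sort_left (snd x))),
     tedges = concat (map (layer (fst x) (snd x)) (fst x)),
     lifetime = length (fst x) + 1,
     source = 0,
     target = 1,
     deadline = 1 \<rparr>"

text \<open>Filtering the given intervals avoids decoding vertex numbers and yields a subset of them
  automatically. A hub counts as a vote for its own interval.\<close>

definition pull_back :: "(interval list \<times> interval list) \<times> nat list \<Rightarrow> interval list" where
  "pull_back w = filter (\<lambda>I. list_ex (\<lambda>v. v = ivertex (snd (fst w)) I \<or> v = hvertex (snd (fst w)) I)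
     (snd w)) (snd (fst w))"

lemma ptime_inside:
  assumes "ptime e enc_interval I" "ptime e enc_rat p"
  shows "ptime e enc_bool (\<lambda>x. inside (I x) (p x))"
  unfolding inside_def by (rule ptime_conj ptime_rat_le ptime_fst ptime_snd assms)+

text \<open>No entry survives in both lists, and the extra 1 is the second terminating
  \<open>Leaf\<close>. Hence \<open>insert_left\<close> enlarges its accumulator only by the new
  entry.\<close>

lemma tsize_enc_list_filter_disjoint:
  assumes "\<And>x. \<not> (P x \<and> Q x)"
  shows "tsize (enc_list ea (filter P xs)) + tsize (enc_list ea (filter Q xs)) \<le> 1 + tsize (enc_list ea xs)"
  using assms by (induction xs) auto

lemma ptime_sort_left:
  assumes "ptime e (enc_list enc_interval) xs"
  shows "ptime e (enc_list enc_interval) (\<lambda>x. sort_left (xs x))"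
  unfolding sort_left_def
proof (rule ptime_foldl[where F = "\<lambda>x. insert_left" and h = "\<lambda>n. 1 + n", OF assms ptime_const])
  show "tsize (enc_list enc_interval (insert_left ys I))
    \<le> tsize (enc_list enc_interval ys) + (1 + (tsize (e x) + tsize (enc_interval I)))" for x ys I
    using tsize_append[of enc_interval "filter (\<lambda>J. fst J < fst I) ys" "I # filter (\<lambda>J. fst I < fst J) ys"]
      tsize_enc_list_filter_disjoint[of "\<lambda>J. fst J < fst I" "\<lambda>J. fst I < fst J" enc_interval ys]
    by (simp add: insert_left_def)
qed (unfold insert_left_def, (rule ptime_intros ptime_rat_less poly_bounded_intros)+)

lemma ptime_hubs:
  assumes "ptime e (enc_list enc_interval) xs"
  shows "ptime e (enc_list enc_interval) (\<lambda>x. hubs (xs x))"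
  unfolding hubs_def
proof (rule ptime_foldl[where F = "\<lambda>x. push_hub" and h = "\<lambda>n. 1 + n", OF assms ptime_const])
  show "tsize (enc_list enc_interval (push_hub ys I))
    \<le> tsize (enc_list enc_interval ys) + (1 + (tsize (e x) + tsize (enc_interval I)))" for x ys I
    by (cases ys) (auto simp: push_hub_def)
qed (unfold push_hub_def, (rule ptime_intros ptime_rat_le poly_bounded_intros)+)

lemma ptime_rank:
  assumes "ptime e (enc_list enc_interval) xs" "ptime e enc_interval C"
  shows "ptime e enc_nat (\<lambda>x. rank (xs x) (C x))"
  unfolding rank_def lex_less_def
  by (rule ptime_length ptime_intros ptime_rat_less ptime_rat_eq assms ptime_compose[OF assms(2)])+

lemma ptime_ivertex:
  assumes "ptime e (enc_list enc_interval) xs" "ptime e enc_interval I"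
  shows "ptime e enc_nat (\<lambda>x. ivertex (xs x) (I x))"
  unfolding ivertex_def by (rule ptime_double ptime_add ptime_rank ptime_const assms)+

lemma ptime_hvertex:
  assumes "ptime e (enc_list enc_interval) xs" "ptime e enc_interval I"
  shows "ptime e enc_nat (\<lambda>x. hvertex (xs x) (I x))"
  unfolding hvertex_def by (rule ptime_Suc_double ptime_add ptime_rank ptime_const assms)+

lemma ptime_inner_path:
  assumes "ptime e (enc_list enc_interval) xs" "ptime e enc_interval C"
  shows "ptime e (enc_list enc_nat) (\<lambda>x. inner_path (xs x) (C x))"
  unfolding inner_path_def
  by (rule ptime_append ptime_map ptime_filter ptime_take_1 ptime_hubs ptime_sort_left ptime_ivertex
      ptime_hvertex ptime_inside ptime_conj ptime_not ptime_fst ptime_snd ptime_id assms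
      ptime_compose[OF assms(1)] ptime_compose[OF assms(2)])+

lemma ptime_links:
  assumes "ptime e (enc_list ea) vs" "ptime e ea u"
  shows "ptime e (enc_list (enc_pair ea ea)) (\<lambda>x. links (vs x) (u x))"
  unfolding links_def
proof (rule ptime_snd[OF ptime_foldl[where F = "\<lambda>x w v. (v, (fst w, v) # snd w)" and
        h = "\<lambda>n. 2 + 2 * n" and eb = "enc_pair ea (enc_list (enc_pair ea ea))" and ea = ea, OF assms(1)]])
qed (rule ptime_intros assms ptime_const poly_bounded_intros | simp add: enc_pair_def)+

lemma ptime_layer:
  assumes "ptime e (enc_list enc_interval) \<Gamma>" "ptime e (enc_list enc_interval) xs" "ptime e enc_interval C"
  shows "ptime e (enc_list (enc_pair enc_nat (enc_pair enc_nat enc_nat))) (\<lambda>x. layer (\<Gamma> x) (xs x) (C x))"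
  unfolding layer_def
  by (rule ptime_concat ptime_map ptime_links ptime_append ptime_inner_path ptime_Cons ptime_Pair
      ptime_fst ptime_snd ptime_id ptime_add ptime_rank assms ptime_compose[OF assms(1)]
      ptime_compose[OF assms(2)] ptime_compose[OF assms(3)] ptime_const)+

lemma ptime_ts_instance:
  assumes "ptime e (enc_list enc_nat) V" "ptime e (enc_list (enc_pair enc_nat (enc_pair enc_nat enc_nat))) E"
    "ptime e enc_nat \<tau>" "ptime e enc_nat s" "ptime e enc_nat z" "ptime e enc_nat t"
  shows "ptime e enc_ts_instance (\<lambda>x. \<lparr>vertices = V x, tedges = E x, lifetime = \<tau> x, source = s x,
    target = z x, deadline = t x\<rparr>)"
proof -
  let ?enc = "enc_pair (enc_list enc_nat) (enc_pair (enc_list (enc_pair enc_nat (enc_pair enc_nat enc_nat)))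
    (enc_pair enc_nat (enc_pair enc_nat (enc_pair enc_nat enc_nat))))"
  have "ptime ?enc enc_ts_instance (\<lambda>w. \<lparr>vertices = fst w, tedges = fst (snd w),
    lifetime = fst (snd (snd w)), source = fst (snd (snd (snd w))),
    target = fst (snd (snd (snd (snd w)))), deadline = snd (snd (snd (snd (snd w))))\<rparr>)"
    by (rule ptime_expr[of "Var 0"]) (simp add: enc_pair_def enc_ts_instance_def)
  from ptime_compose[OF this, of e "\<lambda>x. (V x, E x, \<tau> x, s x, z x, t x)"] show ?thesis
    by (simp add: assms ptime_Pair)
qed

abbreviation enc_instance :: "interval list \<times> interval list \<Rightarrow> tree" where
  "enc_instance \<equiv> enc_pair (enc_list enc_interval) (enc_list enc_interval)"

lemma ptime_reduction: "ptime enc_instance enc_ts_instance reduction"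
proof -
  have "ptime enc_instance enc_ts_instance (\<lambda>x. reduction x)"
    unfolding reduction_def
    by (rule ptime_ts_instance ptime_concat ptime_map ptime_layer ptime_Cons ptime_append ptime_hubs
        ptime_sort_left ptime_ivertex ptime_hvertex ptime_length ptime_add ptime_fst ptime_snd ptime_id
        ptime_const)+
  then show ?thesis .
qed

lemma ptime_pull_back:
  "ptime (enc_pair enc_instance (enc_list enc_nat)) (enc_list enc_interval) pull_back"
proof -
  have "ptime (enc_pair enc_instance (enc_list enc_nat)) (enc_list enc_interval) (\<lambda>x. pull_back x)"
    unfolding pull_back_def
    by (rule ptime_filter ptime_list_ex ptime_disj ptime_nat_eq ptime_ivertex ptime_hvertex
        ptime_fst ptime_snd ptime_id)+
  then show ?thesis .
qed

subsection \<open>Layered temporal graphs\<close>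

lemma set_links: "set (links vs u) = set (zip (u # vs) vs)"
proof -
  have "set (snd (foldl (\<lambda>w v. (v, (fst w, v) # snd w)) (u, acc) vs)) = set acc \<union> set (zip (u # vs) vs)"
    for acc
  proof (induction vs arbitrary: u acc)
    case (Cons v vs)
    show ?case using Cons.IH[of v "(u, v) # acc"] by auto
  qed simp
  from this[of "[]"] show ?thesis by (simp add: links_def)
qed

lemma set_zip_tl: "set (zip (u # vs) vs) = {((u # vs) ! i, (u # vs) ! Suc i) | i. i < length vs}"
  by (auto simp: set_zip)

text \<open>Abstracts from intervals: each \<open>C\<close> contributes the path s,
  \<open>m C\<close>, z at time \<open>t C\<close>. The separation argument needs only that the
  labels are injective and the paths simple.\<close>

definition layered_edges :: "'v \<Rightarrow> 'v \<Rightarrow> 'c set \<Rightarrow> ('c \<Rightarrow> 'v list) \<Rightarrow> ('c \<Rightarrow> nat) \<Rightarrow> 'v tedge set" where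
  "layered_edges s z A m t = {(u, v, i). \<exists>C\<in>A. i = t C \<and>
     ((u, v) \<in> set (zip (s # m C @ [z]) (m C @ [z])) \<or> (v, u) \<in> set (zip (s # m C @ [z]) (m C @ [z])))}"

lemma layer_is_temporal_path:
  fixes t :: "'c \<Rightarrow> nat"
  assumes C: "C \<in> A" and dist: "distinct (s # m C @ [z])"
  defines "p \<equiv> map (\<lambda>w. (fst w, snd w, t C)) (zip (s # m C @ [z]) (m C @ [z]))"
  shows "temporal_path (layered_edges s z A m t) s z p" "travelling_time p = 1"
    "path_vertices p \<subseteq> set (s # m C @ [z])"
proof -
  let ?P = "s # m C @ [z]"
  have len: "length p = Suc (length (m C))" by (simp add: p_def)
  have nth: "p ! i = (?P ! i, ?P ! Suc i, t C)" if "i < Suc (length (m C))" for i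
    using that by (simp add: p_def)
  have ne: "p \<noteq> []" using len by auto
  have last: "last p = p ! length (m C)" and hd: "hd p = p ! 0"
    using len ne by (simp_all add: last_conv_nth hd_conv_nth)
  have dst: "map dst p = m C @ [z]"
    by (rule nth_equalityI) (simp_all add: len nth)
  show "temporal_path (layered_edges s z A m t) s z p"
    unfolding temporal_path_def
  proof (intro conjI allI impI)
    show "set p \<subseteq> layered_edges s z A m t"
      using C by (auto simp: p_def layered_edges_def)
    show "src (hd p) = s" unfolding hd by (simp add: nth)
    show "dst (last p) = z" unfolding last by (simp add: nth nth_append)
    show "distinct (s # map dst p)" using dist dst by simp
    show "dst (p ! i) = src (p ! Suc i)" "time (p ! i) \<le> time (p ! Suc i)" if "Suc i < length p" for i
      using that len by (simp_all add: nth)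
  qed (rule ne)
  show "travelling_time p = 1"
    unfolding travelling_time_def last hd by (simp add: nth)
  show "path_vertices p \<subseteq> set ?P"
    unfolding path_vertices_def p_def by (auto dest: set_zip_leftD set_zip_rightD)
qed

text \<open>A path of travelling time one stays in one layer, and a layer is a path graph, which cannot
  be crossed without visiting all of its vertices.\<close>

lemma temporal_path_traverses_layer:
  assumes inj: "inj_on t A" and dist: "\<And>C. C \<in> A \<Longrightarrow> distinct (s # m C @ [z])"
    and p: "temporal_path (layered_edges s z A m t) s z p" "travelling_time p \<le> 1"
  obtains C where "C \<in> A" "set (m C) \<subseteq> path_vertices p"
proof -
  have ne: "p \<noteq> []" and sub: "set p \<subseteq> layered_edges s z A m t"
    and s: "src (hd p) = s" and z: "dst (last p) = z"
    and step: "\<And>i. Suc i < length p \<Longrightarrow> dst (p ! i) = src (p ! Suc i)"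
    and mono: "\<And>i. Suc i < length p \<Longrightarrow> time (p ! i) \<le> time (p ! Suc i)"
    using p(1) unfolding temporal_path_def by auto
  have le: "time (p ! i) \<le> time (p ! j)" if "i \<le> j" "j < length p" for i j
    using that
  proof (induction j rule: dec_induct)
    case (step j)
    then show ?case using mono[of j] by auto
  qed simp
  \<comment> \<open>Subtraction truncates, so travelling time one says only that the last time is
    not later than the first. Monotonicity then makes all times equal.\<close>
  have "time (last p) \<le> time (hd p)" using p(2) by (simp add: travelling_time_def)
  then have last: "time (p ! (length p - 1)) \<le> time (p ! 0)"
    using ne by (simp add: hd_conv_nth last_conv_nth)
  have eq: "time (p ! i) = time (hd p)" if "i < length p" for i
  proof -
    have "i \<le> length p - 1" "length p - 1 < length p" using that by auto
    then show ?thesis using le[of 0 i] le[of i "length p - 1"] that ne last by (simp add: hd_conv_nth)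
  qed
  have "hd p \<in> layered_edges s z A m t" using ne sub by (meson hd_in_set subsetD)
  then obtain C where C: "C \<in> A" "time (hd p) = t C" by (auto simp: layered_edges_def)
  define P where "P = s # m C @ [z]"
  have edge: "\<exists>a. Suc a < length P \<and> (src (p ! i) = P ! a \<and> dst (p ! i) = P ! Suc a \<or>
      src (p ! i) = P ! Suc a \<and> dst (p ! i) = P ! a)" if i: "i < length p" for i
  proof -
    have "p ! i \<in> layered_edges s z A m t" using sub i by (meson nth_mem subsetD)
    moreover have "time (p ! i) = t C" using eq[OF i] C by simp
    ultimately obtain D where "D \<in> A" "t D = t C"
      "(src (p ! i), dst (p ! i)) \<in> set (zip (s # m D @ [z]) (m D @ [z])) \<or>
       (dst (p ! i), src (p ! i)) \<in> set (zip (s # m D @ [z]) (m D @ [z]))"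
      by (auto simp: layered_edges_def)
    moreover from this have "D = C" using inj C(1) by (auto dest: inj_onD)
    ultimately show ?thesis unfolding set_zip_tl P_def by auto
  qed
  have inj_P: "a = b" if "P ! a = P ! b" "a < length P" "b < length P" for a b
    using dist[OF C(1)] that nth_eq_iff_index_eq unfolding P_def by blast
  have "w \<in> path_vertices p" if w: "w \<in> set (m C)" for w
  proof (rule ccontr)
    assume w': "w \<notin> path_vertices p"
    obtain l where l: "l < length (m C)" "w = m C ! l" using w by (metis in_set_conv_nth)
    define j where "j = Suc l"
    have j: "P ! j = w" "Suc j < length P" "0 < j" using l by (auto simp: P_def j_def nth_append)
    have avoid: "dst (p ! i) \<noteq> P ! j" if "i < length p" for i
      using w' that unfolding j(1) path_vertices_def by auto
    \<comment> \<open>A discrete intermediate value argument: each edge changes the position in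
      \<open>P\<close> by one, forwards or backwards, so a walk that avoids position
      \<open>j\<close> cannot pass it.\<close>
    have stay: "\<exists>b<j. dst (p ! i) = P ! b" if a: "a < j" "src (p ! i) = P ! a" "i < length p" for i a
    proof -
      obtain c where c: "Suc c < length P"
        "src (p ! i) = P ! c \<and> dst (p ! i) = P ! Suc c \<or> src (p ! i) = P ! Suc c \<and> dst (p ! i) = P ! c"
        using edge[OF a(3)] by blast
      have "a < length P" using a(1) j(2) by simp
      from c(2) show ?thesis
      proof (elim disjE conjE)
        assume *: "src (p ! i) = P ! c" "dst (p ! i) = P ! Suc c"
        then have "a = c" using inj_P[of a c] a(2) c(1) \<open>a < length P\<close> by simp
        moreover have "Suc c \<noteq> j" using avoid[OF a(3)] *(2) by auto
        ultimately have "Suc c < j" using a(1) by simp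
        then show ?thesis using *(2) by blast
      next
        assume *: "src (p ! i) = P ! Suc c" "dst (p ! i) = P ! c"
        then have "a = Suc c" using inj_P[of a "Suc c"] a(2) c(1) \<open>a < length P\<close> by simp
        then have "c < j" using a(1) by simp
        then show ?thesis using *(2) by blast
      qed
    qed
    have "\<exists>b<j. dst (p ! i) = P ! b" if "i < length p" for i
      using that
    proof (induction i)
      case 0
      have "src (p ! 0) = P ! 0" using s ne by (simp add: hd_conv_nth P_def)
      then show ?case using stay[of 0 0] 0 j(3) by blast
    next
      case (Suc i)
      then obtain b where "b < j" "dst (p ! i) = P ! b" by auto
      then show ?case using stay[of b "Suc i"] step[of i] Suc.prems by simp
    qed
    from this[of "length p - 1"] obtain b where b: "b < j" "z = P ! b"
      using ne z by (auto simp: last_conv_nth)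
    \<comment> \<open>The target sits at the last position of \<open>P\<close>, which lies beyond
      \<open>j\<close>.\<close>
    have "P ! (length P - 1) = z" "0 < length P" by (simp_all add: P_def nth_append)
    then have "b = length P - 1" using b j(2) by (intro inj_P) auto
    then show False using b(1) j(2) by simp
  qed
  then show thesis using that C(1) by blast
qed

lemma temporal_separator_layered_iff:
  assumes inj: "inj_on t A" and dist: "\<And>C. C \<in> A \<Longrightarrow> distinct (s # m C @ [z])"
  shows "temporal_separator V (layered_edges s z A m t) s z 1 S \<longleftrightarrow>
    S \<subseteq> V - {s, z} \<and> (\<forall>C\<in>A. S \<inter> set (m C) \<noteq> {})"
proof
  assume S: "temporal_separator V (layered_edges s z A m t) s z 1 S"
  have "S \<inter> set (m C) \<noteq> {}" if C: "C \<in> A" for C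
  proof -
    let ?p = "map (\<lambda>w. (fst w, snd w, t C)) (zip (s # m C @ [z]) (m C @ [z]))"
    note p = layer_is_temporal_path[where m = m and t = t, OF C dist[OF C]]
    have "S \<inter> path_vertices ?p \<noteq> {}"
      using S p(1,2) by (auto simp: temporal_separator_def)
    then show ?thesis using p(3) S by (auto simp: temporal_separator_def)
  qed
  then show "S \<subseteq> V - {s, z} \<and> (\<forall>C\<in>A. S \<inter> set (m C) \<noteq> {})"
    using S by (auto simp: temporal_separator_def)
next
  assume S: "S \<subseteq> V - {s, z} \<and> (\<forall>C\<in>A. S \<inter> set (m C) \<noteq> {})"
  have "S \<inter> path_vertices p \<noteq> {}"
    if p: "temporal_path (layered_edges s z A m t) s z p" "travelling_time p \<le> 1" for p
  proof -
    obtain C where "C \<in> A" "set (m C) \<subseteq> path_vertices p"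
      using temporal_path_traverses_layer[OF inj dist p] .
    then show ?thesis using S by blast
  qed
  then show "temporal_separator V (layered_edges s z A m t) s z 1 S"
    using S by (auto simp: temporal_separator_def)
qed

section \<open>Ranks as vertex numbers\<close>

lemma length_filter_strict_mono:
  assumes "\<And>y. P y \<Longrightarrow> Q y" "x \<in> set xs" "Q x" "\<not> P x"
  shows "length (filter P xs) < length (filter Q xs)"
proof -
  have "filter P xs = filter P (filter Q xs)" using assms(1) by (auto intro!: filter_cong)
  then show ?thesis using length_filter_less[of x "filter Q xs" P] assms by simp
qed

text \<open>By transitivity all entries below \<open>x\<close> are below \<open>y\<close>, and
  \<open>x\<close> itself is counted for \<open>y\<close> but not for \<open>x\<close>.\<close>

lemma rank_strict_mono: "x \<in> set xs \<Longrightarrow> lex_less x y \<Longrightarrow> rank xs x < rank xs y"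
  unfolding rank_def
  by (rule length_filter_strict_mono[where x = x]) (auto simp: lex_less_def)

lemma inj_on_rank: "inj_on (rank xs) (set xs)"
proof (rule inj_onI)
  fix x y assume *: "x \<in> set xs" "y \<in> set xs" "rank xs x = rank xs y"
  then have "\<not> lex_less x y" "\<not> lex_less y x" using rank_strict_mono by fastforce+
  then show "x = y" by (auto simp: lex_less_def prod_eq_iff)
qed

lemma vertex_inj:
  assumes "I \<in> set xs" "J \<in> set xs"
  shows "ivertex xs I = ivertex xs J \<longleftrightarrow> I = J" "hvertex xs I = hvertex xs J \<longleftrightarrow> I = J"
  using inj_on_rank[of xs] assms by (auto simp: ivertex_def hvertex_def dest: inj_onD)

text \<open>Interval vertices are even and at least 2, hub vertices odd and at least 3.\<close>

lemma vertex_distinct [simp]: "ivertex xs I \<noteq> hvertex ys J" "hvertex ys J \<noteq> ivertex xs I"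
  "ivertex xs I \<noteq> 0" "hvertex xs I \<noteq> 0" "ivertex xs I \<noteq> Suc 0" "hvertex xs I \<noteq> Suc 0"
  "0 \<noteq> ivertex xs I" "0 \<noteq> hvertex xs I" "Suc 0 \<noteq> ivertex xs I" "Suc 0 \<noteq> hvertex xs I"
  unfolding ivertex_def hvertex_def by presburger+

section \<open>Sorted unit intervals and sparse hubs\<close>

definition unit_length :: "interval set \<Rightarrow> bool" where
  "unit_length A \<longleftrightarrow> (\<forall>I\<in>A. snd I = fst I + 1)"

abbreviation left_of :: "interval \<Rightarrow> interval \<Rightarrow> bool" where
  "left_of I J \<equiv> fst I < fst J"

lemma unit_length_eqI: "unit_length A \<Longrightarrow> I \<in> A \<Longrightarrow> J \<in> A \<Longrightarrow> fst I = fst J \<Longrightarrow> I = J"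
  by (simp add: unit_length_def prod_eq_iff)

lemma sort_left:
  assumes "unit_length (set xs)"
  shows "set (sort_left xs) = set xs" "sorted_wrt left_of (sort_left xs)"
proof -
  have "set (sort_left xs) = set xs \<and> sorted_wrt left_of (sort_left xs)"
    using assms
  proof (induction xs rule: rev_induct)
    case (snoc I xs)
    then have IH: "set (sort_left xs) = set xs" "sorted_wrt left_of (sort_left xs)"
      by (auto simp: unit_length_def)
    have eq: "sort_left (xs @ [I]) = insert_left (sort_left xs) I"
      by (simp add: sort_left_def)
    have "fst J < fst I \<or> fst I < fst J" if "J \<in> set xs" "J \<noteq> I" for J
    proof -
      have "fst J \<noteq> fst I" using unit_length_eqI[OF snoc.prems, of J I] that by auto
      then show ?thesis by (rule linorder_neqE) auto
    qed
    then have "set (insert_left (sort_left xs) I) = insert I (set xs)"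
      using IH(1) by (auto simp: insert_left_def)
    moreover have "sorted_wrt left_of (insert_left (sort_left xs) I)"
      using IH(2) by (auto simp: insert_left_def sorted_wrt_append sorted_wrt_filter)
    ultimately show ?case by (simp add: eq)
  qed (simp add: sort_left_def)
  then show "set (sort_left xs) = set xs" "sorted_wrt left_of (sort_left xs)" by auto
qed

text \<open>The four properties are proved simultaneously along the prefixes of the list. Keeping
  the top interval could endanger only sparseness, dropping it only the covering property; the test
  in \<open>push_hub\<close> decides exactly between the two.\<close>

lemma hubs:
  assumes "unit_length (set xs)" "sorted_wrt left_of xs"
  shows set_hubs: "set (hubs xs) \<subseteq> set xs"
    and sorted_hubs: "sorted_wrt (\<lambda>I J. left_of J I) (hubs xs)"
    and sparse_hubs: "\<And>a b c. a \<in> set (hubs xs) \<Longrightarrow> b \<in> set (hubs xs) \<Longrightarrow> c \<in> set (hubs xs) \<Longrightarrow>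
      left_of a b \<Longrightarrow> left_of b c \<Longrightarrow> snd a < fst c"
    and covering_hubs: "\<And>I x. I \<in> set xs \<Longrightarrow> inside I x \<Longrightarrow> \<exists>J\<in>set (hubs xs). inside J x"
proof -
  have "set (hubs xs) \<subseteq> set xs \<and> sorted_wrt (\<lambda>I J. left_of J I) (hubs xs) \<and>
    (\<forall>a\<in>set (hubs xs). \<forall>b\<in>set (hubs xs). \<forall>c\<in>set (hubs xs). left_of a b \<longrightarrow> left_of b c \<longrightarrow> snd a < fst c) \<and>
    (\<forall>I x. I \<in> set xs \<longrightarrow> inside I x \<longrightarrow> (\<exists>J\<in>set (hubs xs). inside J x))"
    (is "?P xs")
    using assms
  proof (induction xs rule: rev_induct)
    case (snoc I xs)
    let ?G = "hubs xs"
    from snoc have IH: "set ?G \<subseteq> set xs" "sorted_wrt (\<lambda>I J. left_of J I) ?G"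
      "\<And>a b c. a \<in> set ?G \<Longrightarrow> b \<in> set ?G \<Longrightarrow> c \<in> set ?G \<Longrightarrow>
      left_of a b \<Longrightarrow> left_of b c \<Longrightarrow> snd a < fst c"
      "\<And>I x. I \<in> set xs \<Longrightarrow> inside I x \<Longrightarrow> \<exists>J\<in>set ?G. inside J x"
      by (auto simp: unit_length_def sorted_wrt_append)
    have eq: "hubs (xs @ [I]) = push_hub ?G I" by (simp add: hubs_def)
    have I: "left_of J I" if "J \<in> set ?G" for J
      using that IH(1) snoc.prems(2) by (auto simp: sorted_wrt_append)
    have unit: "snd J = fst J + 1" if "J \<in> set ?G \<or> J = I" for J
      using that IH(1) snoc.prems(1) by (auto simp: unit_length_def)
    show ?case
    proof (cases "\<exists>a\<in>set (tl ?G). fst I \<le> snd a")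
      case True
      then obtain b T a where G: "?G = b # T" "a \<in> set T" "fst I \<le> snd a"
        by (cases ?G) auto
      have push: "push_hub ?G I = I # T" using G by (auto simp: push_hub_def list_ex_iff)
      have ab: "left_of c b" if "c \<in> set T" for c using IH(2) that by (simp add: G(1))
      \<comment> \<open>The dropped \<open>b\<close> still serves as a witness: \<open>x\<close>
        ends before \<open>b\<close> starts, and \<open>b\<close> starts before
        \<open>I\<close>.\<close>
      have sparse: "snd x < fst y" if "x \<in> set T" "w \<in> set T" "left_of x w" "left_of w y" "y = I" for x w y
        using IH(3)[of x w b] ab[OF that(2)] I[of b] that by (auto simp: G(1))
      \<comment> \<open>A point of \<open>b\<close> up to \<open>snd a\<close> lies in
        \<open>a\<close>, since \<open>a\<close> starts further left. A later point lies in
        \<open>I\<close>, which starts no later than \<open>a\<close> ends and itself ends after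
        \<open>b\<close>.\<close>
      have cover: "\<exists>J\<in>set (I # T). inside J x" if x: "inside b x" for x
      proof (cases "x \<le> snd a")
        case True
        then have "inside a x" using x ab[OF G(2)] by (auto simp: inside_def)
        then show ?thesis using G(2) by auto
      next
        case False
        then have "inside I x"
          using x G(3) I[of b] unit[of b] unit[of I] by (auto simp: inside_def G(1))
        then show ?thesis by auto
      qed
      show ?thesis
        unfolding eq push
      proof (intro conjI ballI allI impI)
        show "set (I # T) \<subseteq> set (xs @ [I])" using IH(1) by (auto simp: G(1))
        show "sorted_wrt (\<lambda>I J. left_of J I) (I # T)" using IH(2) I by (auto simp: G(1))
        show "snd x < fst y" if "x \<in> set (I # T)" "w \<in> set (I # T)" "y \<in> set (I # T)" "left_of x w" "left_of w y"
          for x w y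
        proof -
          have "fst u \<le> fst I" if "u \<in> set (I # T)" for u using that I[of u] by (auto simp: G(1))
          from this[of w] this[of y] have "x \<noteq> I" "w \<noteq> I" using that by auto
          then show ?thesis using that sparse[of x w y] IH(3)[of x w y] by (cases "y = I") (auto simp: G(1))
        qed
        show "\<exists>J\<in>set (I # T). inside J x" if "K \<in> set (xs @ [I])" "inside K x" for K x
        proof (cases "K = I")
          case False
          then have "\<exists>J\<in>set ?G. inside J x" using IH(4) that by auto
          then show ?thesis using cover by (auto simp: G(1))
        qed (use that in auto)
      qed
    next
      case False
      have push: "push_hub ?G I = I # ?G" using False by (auto simp: push_hub_def list_ex_iff)
      \<comment> \<open>An interval with another one to its right is not the top of the decreasing
        list, so the failed test applies to it.\<close>
      have sparse: "snd x < fst I" if "x \<in> set ?G" "w \<in> set ?G" "left_of x w" for x w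
      proof -
        have "x \<in> set (tl ?G)" using that IH(2) by (cases ?G) (auto dest: less_asym)
        then show ?thesis using False by auto
      qed
      show ?thesis
        unfolding eq push
      proof (intro conjI ballI allI impI)
        show "set (I # ?G) \<subseteq> set (xs @ [I])" using IH(1) by auto
        show "sorted_wrt (\<lambda>I J. left_of J I) (I # ?G)" using IH(2) I by auto
        show "snd x < fst y" if "x \<in> set (I # ?G)" "w \<in> set (I # ?G)" "y \<in> set (I # ?G)" "left_of x w" "left_of w y"
          for x w y
        proof -
          have "fst u \<le> fst I" if "u \<in> set (I # ?G)" for u using that I[of u] by auto
          from this[of w] this[of y] have "x \<noteq> I" "w \<noteq> I" using that by auto
          then show ?thesis using that sparse[of x w] IH(3)[of x w y] by (cases "y = I") auto
        qed
        show "\<exists>J\<in>set (I # ?G). inside J x" if "K \<in> set (xs @ [I])" "inside K x" for K x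
          using that IH(4)[of K x] by (cases "K = I") auto
      qed
    qed
  qed (simp add: hubs_def)
  then show "set (hubs xs) \<subseteq> set xs" "sorted_wrt (\<lambda>I J. left_of J I) (hubs xs)"
    "\<And>a b c. a \<in> set (hubs xs) \<Longrightarrow> b \<in> set (hubs xs) \<Longrightarrow> c \<in> set (hubs xs) \<Longrightarrow>
      left_of a b \<Longrightarrow> left_of b c \<Longrightarrow> snd a < fst c"
    "\<And>I x. I \<in> set xs \<Longrightarrow> inside I x \<Longrightarrow> \<exists>J\<in>set (hubs xs). inside J x"
    by blast+
qed

text \<open>A third point in a closed unit window would lie strictly between its minimum and maximum
  and force these more than 1 apart. Longer windows are cut into closed windows of length
  one.\<close>

lemma card_sparse_le:
  fixes X :: "rat set"
  assumes "finite X" and sparse: "\<And>a b c. a \<in> X \<Longrightarrow> b \<in> X \<Longrightarrow> c \<in> X \<Longrightarrow> a < b \<Longrightarrow> b < c \<Longrightarrow> a + 1 < c"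
  shows "card (X \<inter> {y..y + of_nat (Suc n)}) \<le> 2 * Suc n"
proof -
  have one: "card (X \<inter> {y..y + 1}) \<le> 2" for y
  proof (rule ccontr)
    let ?Y = "X \<inter> {y..y + 1}"
    assume "\<not> card ?Y \<le> 2"
    moreover have "card ?Y \<le> card {Min ?Y, Max ?Y}" if "?Y \<subseteq> {Min ?Y, Max ?Y}"
      using that by (intro card_mono) auto
    moreover have "card {Min ?Y, Max ?Y} \<le> 2" by (simp add: card_insert_if)
    ultimately obtain v where v: "v \<in> ?Y" "v \<noteq> Min ?Y" "v \<noteq> Max ?Y" by fastforce
    have fin: "finite ?Y" using assms(1) by simp
    have "Min ?Y \<in> ?Y" "Max ?Y \<in> ?Y" using fin v(1) by (metis Min_in empty_iff, metis Max_in empty_iff)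
    moreover have "Min ?Y < v" "v < Max ?Y"
      using v Min_le[OF fin v(1)] Max_ge[OF fin v(1)] by auto
    ultimately have "Min ?Y + 1 < Max ?Y" "y \<le> Min ?Y" "Max ?Y \<le> y + 1"
      using sparse[of "Min ?Y" v "Max ?Y"] v(1) by auto
    then show False by linarith
  qed
  show ?thesis
  proof (induction n)
    case 0
    then show ?case using one by simp
  next
    case (Suc n)
    have "X \<inter> {y..y + of_nat (Suc (Suc n))} \<subseteq>
      (X \<inter> {y..y + of_nat (Suc n)}) \<union> (X \<inter> {y + of_nat (Suc n)..(y + of_nat (Suc n)) + 1})"
      by (auto simp: algebra_simps)
    then have "card (X \<inter> {y..y + of_nat (Suc (Suc n))}) \<le>
      card ((X \<inter> {y..y + of_nat (Suc n)}) \<union> (X \<inter> {y + of_nat (Suc n)..(y + of_nat (Suc n)) + 1}))"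
      by (intro card_mono) (use assms(1) in auto)
    also have "\<dots> \<le> card (X \<inter> {y..y + of_nat (Suc n)}) + card (X \<inter> {y + of_nat (Suc n)..(y + of_nat (Suc n)) + 1})"
      by (rule card_Un_le)
    finally show ?case using Suc one[of "y + of_nat (Suc n)"] by simp
  qed
qed

subsection \<open>Correctness and pathwidth\<close>

lemma successively_zip:
  "successively R (u # vs) \<Longrightarrow> (a, b) \<in> set (zip (u # vs) vs) \<Longrightarrow> R a b"
  by (induction vs arbitrary: u) auto

definition next_to :: "interval set \<Rightarrow> interval \<Rightarrow> interval \<Rightarrow> bool" where
  "next_to A I J \<longleftrightarrow> left_of I J \<and> (\<forall>K\<in>A. \<not> (left_of I K \<and> left_of K J))"

lemma successively_next_to:
  "sorted_wrt left_of xs \<Longrightarrow> successively (next_to (set xs)) xs"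
proof (induction xs)
  case (Cons x xs)
  then have "successively (next_to (set xs)) xs" by simp
  then have "successively (next_to (set (x # xs))) xs"
    by (rule successively_mono) (use Cons.prems in \<open>auto simp: next_to_def dest: less_asym\<close>)
  moreover have "next_to (set (x # xs)) x (hd xs)" if "xs \<noteq> []"
    using Cons.prems that by (cases xs) (auto simp: next_to_def dest: less_asym)
  ultimately show ?case by (auto simp: successively_Cons)
qed simp

text \<open>The condition on \<open>Q\<close> is convexity along the sorted list. A convex selection
  has no gaps, so successors within the selection are successors among all intervals.\<close>

lemma successively_filter_next_to:
  assumes "sorted_wrt left_of xs"
    and "\<And>X Y Z. X \<in> set xs \<Longrightarrow> Y \<in> set xs \<Longrightarrow> Z \<in> set xs \<Longrightarrow> Q X \<Longrightarrow> Q Z \<Longrightarrow>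
      left_of X Y \<Longrightarrow> left_of Y Z \<Longrightarrow> Q Y"
  shows "successively (next_to (set xs)) (filter Q xs)"
proof -
  have "successively (next_to (set (filter Q xs))) (filter Q xs)"
    by (rule successively_next_to) (rule sorted_wrt_filter[OF assms(1)])
  then show ?thesis
  proof (rule successively_mono)
    fix X Z
    assume XZ: "X \<in> set (filter Q xs)" "Z \<in> set (filter Q xs)" "next_to (set (filter Q xs)) X Z"
    show "next_to (set xs) X Z"
      unfolding next_to_def
    proof (intro conjI ballI notI; (elim conjE)?)
      fix Y assume Y: "Y \<in> set xs" "left_of X Y" "left_of Y Z"
      then have "Y \<in> set (filter Q xs)" using assms(2)[of X Y Z] XZ by simp
      then show False using Y XZ(3) unfolding next_to_def by blast
    qed (use XZ(3) in \<open>simp add: next_to_def\<close>)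
  qed
qed

lemma tedges_reduction:
  "set (tedges (reduction (\<Gamma>, xs))) =
     layered_edges 0 1 (set \<Gamma>) (inner_path xs) (\<lambda>C. rank \<Gamma> C + 1)"
proof -
  have *: "(\<exists>w\<in>Z. (u, v, i) = (fst w, snd w, t) \<or> (u, v, i) = (snd w, fst w, t)) \<longleftrightarrow>
      i = t \<and> ((u, v) \<in> Z \<or> (v, u) \<in> Z)" for u v i t :: nat and Z
  proof (intro iffI; elim conjE disjE bexE)
    show "\<exists>w\<in>Z. (u, v, i) = (fst w, snd w, t) \<or> (u, v, i) = (snd w, fst w, t)"
      if "i = t" "(u, v) \<in> Z" using that by (intro bexI[of _ "(u, v)"]) simp_all
    show "\<exists>w\<in>Z. (u, v, i) = (fst w, snd w, t) \<or> (u, v, i) = (snd w, fst w, t)"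
      if "i = t" "(v, u) \<in> Z" using that by (intro bexI[of _ "(v, u)"]) simp_all
  qed auto
  have "(u, v, i) \<in> set (tedges (reduction (\<Gamma>, xs))) \<longleftrightarrow>
    (\<exists>C\<in>set \<Gamma>. \<exists>w\<in>set (zip (0 # inner_path xs C @ [1]) (inner_path xs C @ [1])).
      (u, v, i) = (fst w, snd w, rank \<Gamma> C + 1) \<or> (u, v, i) = (snd w, fst w, rank \<Gamma> C + 1))" for u v i
    by (simp add: reduction_def layer_def set_links)
  then have "e \<in> set (tedges (reduction (\<Gamma>, xs))) \<longleftrightarrow>
    e \<in> layered_edges 0 1 (set \<Gamma>) (inner_path xs) (\<lambda>C. rank \<Gamma> C + 1)" for e
    by (cases e) (simp only: * layered_edges_def mem_Collect_eq case_prod_conv)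
  then show ?thesis by blast
qed

lemma zip_path_distinct:
  "distinct (u # vs) \<Longrightarrow> (a, b) \<in> set (zip (u # vs) vs) \<Longrightarrow> a \<noteq> b"
  by (induction vs arbitrary: u) auto

lemma covers_iff: "covers I C \<longleftrightarrow> inside I (fst C) \<or> inside I (snd C)"
  by (simp add: covers_def inside_def)

section \<open>Covers and separators of a fixed instance\<close>

locale instance_k =
  fixes k :: nat and \<Gamma> xs :: "interval list"
  assumes segments: "C \<in> set \<Gamma> \<Longrightarrow> fst C \<le> snd C \<and> snd C - fst C \<le> of_nat k"
    and unit: "unit_length (set xs)"
begin

definition "L = sort_left xs"
definition "H = hubs L"
definition "V = set (vertices (reduction (\<Gamma>, xs)))"
definition "E = set (tedges (reduction (\<Gamma>, xs)))"

lemma set_L: "set L = set xs" and sorted_L: "sorted_wrt left_of L"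
  using sort_left[OF unit] by (auto simp: L_def)

lemma unit_L: "unit_length (set L)"
  using unit set_L by simp

lemmas H = hubs[OF unit_L sorted_L, folded H_def]

lemma interval_eqI: "I \<in> set xs \<Longrightarrow> J \<in> set xs \<Longrightarrow> fst I = fst J \<Longrightarrow> I = J"
  by (rule unit_length_eqI[OF unit])

lemma snd_eq: "I \<in> set xs \<Longrightarrow> snd I = fst I + 1"
  using unit by (simp add: unit_length_def)

lemma H_subset: "set H \<subseteq> set xs"
  using H(1) set_L by simp

lemma V_eq: "V = {0, 1} \<union> ivertex xs ` set xs \<union> hvertex xs ` set H"
  by (auto simp: V_def reduction_def L_def[symmetric] H_def[symmetric] set_L)

lemma inner_path_eq: "inner_path xs C =
     map (ivertex xs) (filter (\<lambda>I. inside I (fst C)) L) @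
     map (hvertex xs) (take 1 (filter (\<lambda>J. inside J (fst C)) H)) @
     map (ivertex xs) (filter (\<lambda>I. inside I (snd C) \<and> \<not> inside I (fst C)) L)"
  by (simp add: inner_path_def L_def H_def)

lemma set_inner_path: "v \<in> set (inner_path xs C) \<Longrightarrow>
    (\<exists>I\<in>set xs. v = ivertex xs I \<and> (inside I (fst C) \<or> inside I (snd C))) \<or>
    (\<exists>J\<in>set H. v = hvertex xs J \<and> inside J (fst C))"
  unfolding inner_path_eq using set_L by (auto dest!: in_set_takeD)

lemma ivertex_in_inner_path:
  "I \<in> set xs \<Longrightarrow> inside I (fst C) \<or> inside I (snd C) \<Longrightarrow> ivertex xs I \<in> set (inner_path xs C)"
  unfolding inner_path_eq using set_L by auto

lemma inner_path_subset: "set (inner_path xs C) \<subseteq> V - {0, 1}"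
proof
  fix v assume "v \<in> set (inner_path xs C)"
  from set_inner_path[OF this] show "v \<in> V - {0, 1}" by (elim disjE bexE) (auto simp: V_eq)
qed

lemma distinct_path: "distinct (0 # inner_path xs C @ [1])"
proof -
  have "sorted_wrt (<) (map fst L)" using sorted_L by (simp add: sorted_wrt_map)
  then have dL: "distinct L" by (metis distinct_map strict_sorted_iff)
  have inj: "inj_on (ivertex xs) (set L)" using vertex_inj(1) set_L by (auto intro!: inj_onI)
  have "distinct (map (hvertex xs) (take 1 ys))" for ys by (cases ys) auto
  moreover have "distinct (map (ivertex xs) (filter P L))" for P
    using dL inj by (auto simp: distinct_map intro: inj_on_subset)
  moreover have "ivertex xs ` set (filter (\<lambda>I. P I) L) \<inter> ivertex xs ` set (filter (\<lambda>I. Q I \<and> \<not> P I) L) = {}"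
    for P Q
    by (subst inj_on_image_Int[OF inj, symmetric]) auto
  ultimately have "distinct (inner_path xs C)"
    unfolding inner_path_eq distinct_append set_append set_map Int_Un_distrib
    by (simp add: disjoint_iff) auto
  then show ?thesis using inner_path_subset[of C] by auto
qed

lemma separator_iff:
  "temporal_separator V E 0 1 1 S \<longleftrightarrow> S \<subseteq> V - {0, 1} \<and> (\<forall>C\<in>set \<Gamma>. S \<inter> set (inner_path xs C) \<noteq> {})"
  unfolding E_def tedges_reduction
proof (rule temporal_separator_layered_iff)
  show "inj_on (\<lambda>C. rank \<Gamma> C + 1) (set \<Gamma>)"
    using inj_on_rank[of \<Gamma>] by (auto simp: inj_on_def)
qed (rule distinct_path)

text \<open>No hub is chosen: the path of a segment already visits every interval that covers the
  segment.\<close>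

lemma separator_of_cover:
  assumes "segment_cover (set \<Gamma>) (set xs) A"
  shows "temporal_separator V E 0 1 1 (ivertex xs ` A)"
  unfolding separator_iff
proof (intro conjI ballI)
  show "ivertex xs ` A \<subseteq> V - {0, 1}" using assms by (auto simp: V_eq segment_cover_def)
  fix C assume "C \<in> set \<Gamma>"
  then obtain I where "I \<in> A" "covers I C" "I \<in> set xs"
    using assms unfolding segment_cover_def by blast
  then show "ivertex xs ` A \<inter> set (inner_path xs C) \<noteq> {}"
    using ivertex_in_inner_path[of I C] unfolding covers_iff by blast
qed

lemma cover_of_separator:
  assumes S: "temporal_separator V E 0 1 1 (set S)"
  shows "segment_cover (set \<Gamma>) (set xs) (set (pull_back ((\<Gamma>, xs), S)))"
proof -
  have set_g: "set (pull_back ((\<Gamma>, xs), S)) = {I \<in> set xs. ivertex xs I \<in> set S \<or> hvertex xs I \<in> set S}"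
    by (auto simp: pull_back_def list_ex_iff)
  show ?thesis
    unfolding segment_cover_def
  proof (intro conjI ballI)
    fix C assume "C \<in> set \<Gamma>"
    then obtain v where v: "v \<in> set S" "v \<in> set (inner_path xs C)"
      using S unfolding separator_iff by blast
    from set_inner_path[OF v(2)] show "\<exists>I\<in>set (pull_back ((\<Gamma>, xs), S)). covers I C"
      using v(1) H_subset unfolding set_g covers_iff by blast
  qed (simp add: set_g)
qed

text \<open>Each selected interval is charged to one of its own two vertices in \<open>S\<close>,
  and different intervals have different vertices.\<close>

lemma card_pull_back_le: "card (set (pull_back ((\<Gamma>, xs), S))) \<le> card (set S)"
proof (rule card_inj_on_le)
  let ?f = "\<lambda>I. if ivertex xs I \<in> set S then ivertex xs I else hvertex xs I"
  show "?f ` set (pull_back ((\<Gamma>, xs), S)) \<subseteq> set S"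
    by (auto simp: pull_back_def list_ex_iff)
  show "inj_on ?f (set (pull_back ((\<Gamma>, xs), S)))"
    using vertex_inj[of _ xs] by (auto simp: pull_back_def inj_on_def split: if_splits)
qed simp

lemma temporal_graph_reduction: "temporal_graph V E (length \<Gamma> + 1)"
  unfolding temporal_graph_def
proof (intro conjI allI)
  have zip: "a \<in> V \<and> b \<in> V \<and> a \<noteq> b"
    if "(a, b) \<in> set (zip (0 # inner_path xs C @ [1]) (inner_path xs C @ [1]))" for a b C
  proof -
    have "a \<noteq> b" using zip_path_distinct[OF distinct_path that] .
    moreover have "a \<in> set (0 # inner_path xs C @ [1])" "b \<in> set (0 # inner_path xs C @ [1])"
      using set_zip_leftD[OF that] set_zip_rightD[OF that] by auto
    ultimately show ?thesis using inner_path_subset[of C] by (auto simp: V_eq)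
  qed
  show "finite V" by (simp add: V_def)
  show "E \<subseteq> V \<times> V \<times> {1..length \<Gamma> + 1}"
    using zip length_filter_le unfolding E_def tedges_reduction layered_edges_def
    by (auto simp: rank_def)
  show "(u, v, i) \<in> E \<longleftrightarrow> (v, u, i) \<in> E" for u v i
    unfolding E_def tedges_reduction layered_edges_def by auto
  show "(v, v, i) \<notin> E" for v i
    using zip unfolding E_def tedges_reduction layered_edges_def by auto
qed

section \<open>The path decomposition, with one bag per interval\<close>

definition neighbours :: "interval \<Rightarrow> interval set" where
  "neighbours I = {X \<in> set xs. X = I \<or> next_to (set xs) I X}"

text \<open>\<open>fst I\<close> ranges over the window in which the interval neighbours of the hub
  start: they start at or after \<open>fst J\<close>, and at most k to the right of a point of
  \<open>J\<close>.\<close>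

definition live_hubs :: "interval \<Rightarrow> interval set" where
  "live_hubs I = {J \<in> set H. fst J \<le> fst I \<and> fst I \<le> snd J + of_nat k}"

definition bag :: "interval \<Rightarrow> nat set" where
  "bag I = {0, 1} \<union> ivertex xs ` neighbours I \<union> hvertex xs ` live_hubs I"

text \<open>The leading bag makes the list nonempty and accommodates a source-target edge even when
  there are no intervals.\<close>

definition "Bs = {0, 1} # map bag L"

lemma card_neighbours: "card (neighbours I) \<le> 2"
proof -
  obtain Z where "neighbours I \<subseteq> {I, Z}"
  proof (cases "\<exists>Z\<in>set xs. next_to (set xs) I Z")
    case True
    then obtain Z where Z: "Z \<in> set xs" "next_to (set xs) I Z" by blast
    have "X = Z" if "X \<in> set xs" "next_to (set xs) I X" for X
    proof (rule interval_eqI[OF that(1) Z(1)])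
      show "fst X = fst Z" using that Z by (meson linorder_neqE next_to_def)
    qed
    then show thesis by (intro that[of Z]) (auto simp: neighbours_def)
  next
    case False
    then show thesis by (intro that[of I]) (auto simp: neighbours_def)
  qed
  then have "card (neighbours I) \<le> card {I, Z}" by (intro card_mono) auto
  also have "\<dots> \<le> 2" by (simp add: card_insert_if)
  finally show ?thesis .
qed

text \<open>As hub intervals have length one, the left ends of the live ones lie in the window of
  length k + 1 that ends at \<open>fst I\<close>.\<close>

lemma card_live_hubs: "card (live_hubs I) \<le> 2 * Suc k"
proof -
  let ?X = "fst ` set H" and ?y = "fst I - of_nat (Suc k)"
  have snd_H: "snd J = fst J + 1" if "J \<in> set H" for J using that H_subset snd_eq by auto
  have "card (live_hubs I) = card (fst ` live_hubs I)"
  proof (rule card_image[symmetric], rule inj_onI)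
    show "J = K" if "J \<in> live_hubs I" "K \<in> live_hubs I" "fst J = fst K" for J K
      using that H_subset by (intro interval_eqI) (auto simp: live_hubs_def)
  qed
  also have "\<dots> \<le> card (?X \<inter> {?y..?y + of_nat (Suc k)})"
  proof (rule card_mono)
    show "fst ` live_hubs I \<subseteq> ?X \<inter> {?y..?y + of_nat (Suc k)}"
    proof (rule image_subsetI)
      fix J assume "J \<in> live_hubs I"
      then show "fst J \<in> ?X \<inter> {?y..?y + of_nat (Suc k)}"
        using snd_H[of J] by (auto simp: live_hubs_def)
    qed
  qed simp
  also have "\<dots> \<le> 2 * Suc k"
  proof (rule card_sparse_le)
    show "a + 1 < c" if "a \<in> ?X" "b \<in> ?X" "c \<in> ?X" "a < b" "b < c" for a b c
      using that H(3) snd_H by fastforce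
  qed simp
  finally show ?thesis .
qed

lemma card_bag: "card (bag I) \<le> 2 * k + 6"
proof -
  have fin: "finite (neighbours I)" "finite (live_hubs I)"
    by (auto simp: neighbours_def live_hubs_def)
  have "card (bag I) \<le> card ({0, 1} \<union> ivertex xs ` neighbours I) + card (hvertex xs ` live_hubs I)"
    unfolding bag_def by (rule card_Un_le)
  also have "card ({0, 1} \<union> ivertex xs ` neighbours I) \<le> card {0, 1 :: nat} + card (ivertex xs ` neighbours I)"
    by (rule card_Un_le)
  also have "card (ivertex xs ` neighbours I) \<le> 2"
    using card_image_le[OF fin(1)] card_neighbours by (rule order_trans)
  also have "card (hvertex xs ` live_hubs I) \<le> 2 * Suc k"
    using card_image_le[OF fin(2)] card_live_hubs by (rule order_trans)
  finally show ?thesis by simp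
qed

text \<open>Width is the maximal bag size minus one, so the count of bag members leaves one to
  spare.\<close>

lemma width_Bs: "decomposition_width Bs \<le> 2 * k + 6"
proof -
  have "Max (card ` set Bs) \<le> 2 * k + 6"
    by (rule Max.boundedI) (auto simp: Bs_def card_bag)
  then show ?thesis by (simp add: decomposition_width_def)
qed

text \<open>A hub is live for a contiguous range of left ends by definition. An interval vertex
  occurs only in the bags of the interval and of its immediate predecessor.\<close>

lemma bag_interpolation:
  assumes "a \<in> set xs" "b \<in> set xs" "c \<in> set xs" "fst a \<le> fst b" "fst b \<le> fst c"
  shows "bag a \<inter> bag c \<subseteq> bag b"
proof
  fix v assume v: "v \<in> bag a \<inter> bag c"
  have iv: "X \<in> neighbours b" if "X \<in> neighbours a" "X \<in> neighbours c" for X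
  proof (cases "X = b")
    case False
    have "X \<in> set xs" using that by (simp add: neighbours_def)
    have "fst c \<le> fst X" using that(2) by (auto simp: neighbours_def next_to_def)
    moreover have "fst b \<noteq> fst X" using interval_eqI[OF \<open>X \<in> set xs\<close> assms(2)] False by auto
    ultimately have "left_of b X" using assms by simp
    then have "X \<noteq> a" using assms by auto
    then have "next_to (set xs) a X" using that(1) by (auto simp: neighbours_def)
    then have "next_to (set xs) b X"
      using assms(4) \<open>left_of b X\<close> by (auto simp: next_to_def)
    then show ?thesis using \<open>X \<in> set xs\<close> by (simp add: neighbours_def)
  qed (use assms in \<open>simp add: neighbours_def\<close>)
  have hv: "J \<in> live_hubs b" if "J \<in> live_hubs a" "J \<in> live_hubs c" for J
    using that assms by (auto simp: live_hubs_def)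
  have sub: "neighbours I \<subseteq> set xs" "live_hubs I \<subseteq> set xs" for I
    using H_subset by (auto simp: neighbours_def live_hubs_def)
  have "v \<in> {0, 1} \<or> v \<in> ivertex xs ` neighbours I \<or> v \<in> hvertex xs ` live_hubs I"
    if "v \<in> bag I" for I
    using that unfolding bag_def by blast
  from this[of a] this[of c] have "v \<in> {0, 1} \<or> v \<in> ivertex xs ` neighbours a \<or> v \<in> hvertex xs ` live_hubs a"
    "v \<in> {0, 1} \<or> v \<in> ivertex xs ` neighbours c \<or> v \<in> hvertex xs ` live_hubs c"
    using v by simp_all
  \<comment> \<open>The vertex number reveals whether \<open>v\<close> belongs to an interval or to
    a hub, so \<open>v\<close> lies in the same component of both bags.\<close>
  moreover have disj: "v \<notin> ivertex xs ` A \<or> v \<notin> hvertex xs ` B" for A B by auto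
  note disj[of "neighbours a" "live_hubs c"] disj[of "neighbours c" "live_hubs a"]
  ultimately consider "v \<in> {0, 1}"
    | "v \<in> ivertex xs ` neighbours a" "v \<in> ivertex xs ` neighbours c"
    | "v \<in> hvertex xs ` live_hubs a" "v \<in> hvertex xs ` live_hubs c"
    by argo
  then show "v \<in> bag b"
  proof cases
    case 1
    then show ?thesis by (auto simp: bag_def)
  next
    case 2
    then obtain X Y where XY: "X \<in> neighbours a" "Y \<in> neighbours c" "v = ivertex xs X" "v = ivertex xs Y"
      by blast
    then have "X = Y" using vertex_inj(1)[of X xs Y] sub by blast
    then show ?thesis using iv[of X] XY by (simp add: bag_def)
  next
    case 3
    then obtain X Y where XY: "X \<in> live_hubs a" "Y \<in> live_hubs c" "v = hvertex xs X" "v = hvertex xs Y"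
      by blast
    then have "X = Y" using vertex_inj(2)[of X xs Y] sub by blast
    then show ?thesis using hv[of X] XY by (simp add: bag_def)
  qed
qed

definition "together u v \<longleftrightarrow> (\<exists>B\<in>set Bs. {u, v} \<subseteq> B)"

lemma together_bagI: "I \<in> set xs \<Longrightarrow> u \<in> bag I \<Longrightarrow> v \<in> bag I \<Longrightarrow> together u v"
  using set_L by (auto simp: together_def Bs_def)

lemma hub_in_own_bag: "J \<in> set H \<Longrightarrow> hvertex xs J \<in> bag J"
proof -
  assume "J \<in> set H"
  then have "J \<in> live_hubs J" using snd_eq[of J] H_subset by (auto simp: live_hubs_def)
  then show ?thesis by (simp add: bag_def)
qed

lemma ivertex_in_own_bag: "I \<in> set xs \<Longrightarrow> ivertex xs I \<in> bag I"
  by (simp add: bag_def neighbours_def)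

lemma together_end: "v \<in> V \<Longrightarrow> together 0 v \<and> together v 1"
proof -
  have *: "0 \<in> bag I" "1 \<in> bag I" for I by (auto simp: bag_def)
  assume "v \<in> V"
  then consider "v \<in> {0, 1}" | I where "I \<in> set xs" "v = ivertex xs I" | J where "J \<in> set H" "v = hvertex xs J"
    unfolding V_eq by blast
  then show ?thesis
  proof cases
    case 1
    then show ?thesis by (auto simp: together_def Bs_def)
  next
    case 2
    then show ?thesis using * together_bagI[of I] ivertex_in_own_bag by blast
  next
    case 3
    then show ?thesis using * together_bagI[of J] hub_in_own_bag H_subset by blast
  qed
qed

text \<open>Two successive intervals of a run meet in the bag of the left one. The hub meets the
  last member of the first run in the bag of that member, and the first member of the second run
  likewise. Source and target are in all bags.\<close>

lemma successively_together:
  assumes C: "C \<in> set \<Gamma>"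
  shows "successively together (0 # inner_path xs C @ [1])"
proof -
  define p q where "p = fst C" and "q = snd C"
  have pq: "p \<le> q" "q - p \<le> of_nat k" using segments[OF C] by (simp_all add: p_def q_def)
  define A B where "A = filter (\<lambda>I. inside I p) L" and "B = filter (\<lambda>I. inside I q \<and> \<not> inside I p) L"
  define K where "K = take 1 (filter (\<lambda>J. inside J p) H)"
  have eq: "inner_path xs C = map (ivertex xs) A @ map (hvertex xs) K @ map (ivertex xs) B"
    by (simp add: inner_path_eq A_def B_def K_def p_def q_def)
  have AB: "set A = {I \<in> set xs. inside I p}" "set B = {I \<in> set xs. inside I q \<and> \<not> inside I p}"
    using set_L by (auto simp: A_def B_def)
  have right_of_p: "p < fst I" if "I \<in> set B" for I using that pq by (auto simp: AB inside_def)
  \<comment> \<open>By \<open>covering_hubs\<close>, a hub is available whenever the first run is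
    nonempty; conversely, the interval of a hub at p belongs to the first run. So the two runs are
    never joined directly.\<close>
  have K: "A = [] \<and> K = [] \<or> A \<noteq> [] \<and> (\<exists>J. K = [J] \<and> J \<in> set H \<and> inside J p)"
  proof (cases "filter (\<lambda>J. inside J p) H")
    case Nil
    then have "\<not> inside I p" if "I \<in> set xs" for I
      using H(4)[of I p] that set_L by (auto simp: filter_empty_conv)
    then have "set A = {}" by (simp add: AB)
    then show ?thesis using Nil by (simp add: K_def)
  next
    case (Cons J Js)
    then have "J \<in> set (filter (\<lambda>J. inside J p) H)" by simp
    then have J: "J \<in> set H" "inside J p" by simp_all
    then have "J \<in> set A" using H_subset by (auto simp: AB)
    then show ?thesis using Cons J by (auto simp: K_def)
  qed
  have next_to: "together (ivertex xs I) (ivertex xs J)" if "I \<in> set L" "J \<in> set L" "next_to (set L) I J" for I J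
    using that set_L by (intro together_bagI[of I]) (auto simp: bag_def neighbours_def)
  have A: "successively together (map (ivertex xs) A)"
    unfolding successively_map A_def
  proof (rule successively_mono[OF successively_filter_next_to[OF sorted_L]])
    \<comment> \<open>\<open>Y\<close> starts before \<open>Z\<close> does and, by equal lengths,
      ends after \<open>X\<close> does, while both contain p.\<close>
    show "inside Y p"
      if "X \<in> set L" "Y \<in> set L" "Z \<in> set L" "inside X p" "inside Z p"
        "left_of X Y" "left_of Y Z" for X Y Z
      using that snd_eq[of X] snd_eq[of Y] set_L by (simp add: inside_def)
  qed (simp_all add: next_to)
  have B: "successively together (map (ivertex xs) B)"
    unfolding successively_map B_def
  proof (rule successively_mono[OF successively_filter_next_to[OF sorted_L]])
    show "inside Y q \<and> \<not> inside Y p"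
      if "X \<in> set L" "Y \<in> set L" "Z \<in> set L" "inside X q \<and> \<not> inside X p" "inside Z q \<and> \<not> inside Z p"
        "left_of X Y" "left_of Y Z" for X Y Z
    proof -
      \<comment> \<open>\<open>X\<close> contains q but not p, and p \<le> q, so \<open>X\<close>
        lies to the right of p. Hence so does \<open>Y\<close>, which starts later.\<close>
      have "p < fst X" using that(4) pq by (auto simp: inside_def)
      then show ?thesis using that snd_eq[of X] snd_eq[of Y] set_L by (simp add: inside_def)
    qed
  qed (simp_all add: next_to)
  have J_bag: "hvertex xs J \<in> bag I" if "J \<in> set H" "fst J \<le> fst I" "fst I \<le> snd J + of_nat k" for I J
    using that by (simp add: bag_def live_hubs_def)
  have AJ: "together (ivertex xs (last A)) (hvertex xs J)" if "A \<noteq> []" and J: "J \<in> set H" "inside J p" for J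
  proof -
    have I: "last A \<in> set xs" "inside (last A) p" using last_in_set[OF \<open>A \<noteq> []\<close>] AB(1) by auto
    have "sorted_wrt left_of A" unfolding A_def by (rule sorted_wrt_filter[OF sorted_L])
    \<comment> \<open>The interval of the hub is itself a member of the first run, so the last
      member starts no further left.\<close>
    moreover have "J \<in> set A" using J H_subset by (auto simp: AB)
    ultimately have "fst J \<le> fst (last A)"
      by (cases A rule: rev_cases) (auto simp: sorted_wrt_append)
    moreover have "fst (last A) \<le> snd J + of_nat k"
      using I(2) J(2) by (auto simp: inside_def)
    ultimately show ?thesis
      using together_bagI[OF I(1) ivertex_in_own_bag[OF I(1)] J_bag[OF J(1)]] by blast
  qed
  have JB: "together (hvertex xs J) (ivertex xs (hd B))" if "B \<noteq> []" and J: "J \<in> set H" "inside J p" for J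
  proof -
    have I: "hd B \<in> set xs" "inside (hd B) q" "p < fst (hd B)"
      using hd_in_set[OF \<open>B \<noteq> []\<close>] AB(2) right_of_p by auto
    have "fst J \<le> fst (hd B)" "fst (hd B) \<le> snd J + of_nat k"
      using I J(2) pq by (auto simp: inside_def)
    then show ?thesis
      using together_bagI[OF I(1) J_bag[OF J(1)] ivertex_in_own_bag[OF I(1)]] by blast
  qed
  have ends: "together 0 v" "together v 1" if "v \<in> set (inner_path xs C @ [1])" for v
    using that inner_path_subset[of C] together_end[of v] by (auto simp: V_eq)
  have inner: "successively together (inner_path xs C)"
    using K
  proof (elim disjE conjE exE)
    assume "A = []" "K = []"
    then show ?thesis using B by (simp add: eq)
  next
    fix J assume "A \<noteq> []" "K = [J]" "J \<in> set H" "inside J p"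
    then show ?thesis
      using A B AJ JB
      by (cases "B = []") (simp_all add: eq successively_append_iff successively_Cons last_map hd_map)
  qed
  have "successively together (inner_path xs C @ [1])"
    using inner ends(2)[of "last (inner_path xs C)"]
    by (cases "inner_path xs C = []") (simp_all add: successively_append_iff)
  then show ?thesis
    using ends(1)[OF hd_in_set[of "inner_path xs C @ [1]"]] by (simp add: successively_Cons)
qed

lemma path_decomposition_Bs: "path_decomposition V (underlying_edges E) Bs"
  unfolding path_decomposition_def
proof (intro conjI allI impI ballI)
  show "Bs \<noteq> []" by (simp add: Bs_def)
  have "v \<in> \<Union>(set Bs)" if "v \<in> V" for v
    using together_end[OF that] by (auto simp: together_def)
  moreover have "B \<subseteq> V" if "B \<in> set Bs" for B
    using that by (auto simp: Bs_def bag_def V_eq neighbours_def live_hubs_def)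
  ultimately show "\<Union>(set Bs) = V" by blast
next
  fix e assume "e \<in> underlying_edges E"
  then obtain u v C where "e = {u, v}" "C \<in> set \<Gamma>"
    "(u, v) \<in> set (zip (0 # inner_path xs C @ [1]) (inner_path xs C @ [1])) \<or>
     (v, u) \<in> set (zip (0 # inner_path xs C @ [1]) (inner_path xs C @ [1]))"
    unfolding underlying_edges_def E_def tedges_reduction layered_edges_def by blast
  then have "together u v \<or> together v u"
    using successively_zip[OF successively_together] by blast
  then show "\<exists>B\<in>set Bs. e \<subseteq> B" using \<open>e = {u, v}\<close> by (auto simp: together_def)
next
  fix i j l assume ijl: "i \<le> j \<and> j \<le> l \<and> l < length Bs"
  \<comment> \<open>The leading bag contains only 0 and 1, which occur in every bag; for the
    remaining bags indices shift by one against \<open>L\<close>.\<close>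
  have ends: "{0, 1} \<subseteq> Bs ! j" using ijl by (cases j) (auto simp: Bs_def bag_def)
  show "Bs ! i \<inter> Bs ! l \<subseteq> Bs ! j"
  proof (cases i)
    case 0
    then show ?thesis using ends by (auto simp: Bs_def)
  next
    case (Suc i')
    then obtain j' l' where eq: "j = Suc j'" "l = Suc l'" using ijl by (metis Suc_le_D)
    have le: "fst (L ! a) \<le> fst (L ! b)" if "a \<le> b" "b < length L" for a b
      using sorted_L that by (cases "a = b") (auto simp: sorted_wrt_iff_nth_less intro: less_imp_le)
    have "i' \<le> j'" "j' \<le> l'" "l' < length L" using ijl Suc eq by (auto simp: Bs_def)
    moreover from this have "L ! i' \<in> set xs" "L ! j' \<in> set xs" "L ! l' \<in> set xs"
      using set_L nth_mem by (metis le_less_trans)+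
    ultimately show ?thesis
      using bag_interpolation[of "L ! i'" "L ! j'" "L ! l'"] le by (simp add: Bs_def Suc eq)
  qed
qed

lemma pathwidth_le: "pathwidth V (underlying_edges E) \<le> 2 * k + 6"
proof -
  have "pathwidth V (underlying_edges E) \<le> decomposition_width Bs"
    unfolding pathwidth_def by (rule cINF_lower) (auto simp: path_decomposition_Bs)
  then show ?thesis using width_Bs by simp
qed

lemma reduction_instance: "reduction (\<Gamma>, xs) \<in> instances (Temporal_Separator_pw (2 * k + 6))"
proof -
  have "lifetime (reduction (\<Gamma>, xs)) = length \<Gamma> + 1" "source (reduction (\<Gamma>, xs)) = 0"
    "target (reduction (\<Gamma>, xs)) = 1" "deadline (reduction (\<Gamma>, xs)) = 1"
    by (simp_all add: reduction_def)
  then show ?thesis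
    using temporal_graph_reduction pathwidth_le
    by (simp add: Temporal_Separator_pw_def flip: V_def E_def) (simp add: V_eq)
qed

lemma feasible_reduction:
  "feasible (Temporal_Separator_pw w) (reduction (\<Gamma>, xs)) = {S. temporal_separator V E 0 1 1 (set S)}"
  unfolding Temporal_Separator_pw_def V_def E_def by (simp add: reduction_def)

end

theorem theorem10:
  fixes k :: nat
  shows "poly_reduces (DISC_SC_k k) (Temporal_Separator_pw (2 * k + 6))"
  unfolding poly_reduces_def
proof (intro exI conjI ballI)
  let ?P = "DISC_SC_k k" and ?Q = "Temporal_Separator_pw (2 * k + 6)"
  have enc: "enc_inst ?P = enc_instance" "enc_sol ?P = enc_list enc_interval"
    "enc_inst ?Q = enc_ts_instance" "enc_sol ?Q = enc_list enc_nat"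
    by (simp_all add: DISC_SC_k_def Temporal_Separator_pw_def)
  have obj: "objective ?P A = card (set A)" "objective ?Q S = card (set S)" for A S
    by (simp_all add: DISC_SC_k_def Temporal_Separator_pw_def)
  show "polytime_on (enc_inst ?P) (enc_inst ?Q) (instances ?P) reduction"
    unfolding enc by (rule ptime_polytime_on[OF ptime_reduction])
  \<comment> \<open>The reduction preserves the optimal value, so thresholds are passed on
    unchanged.\<close>
  show "polytime_on (enc_pair (enc_inst ?P) enc_nat) enc_nat (instances ?P \<times> UNIV) snd"
    by (rule ptime_polytime_on[OF ptime_snd[OF ptime_id]])
  show "polytime_on (enc_pair (enc_inst ?P) (enc_sol ?Q)) (enc_sol ?P)
     {(x, y). x \<in> instances ?P \<and> optimal ?Q (reduction x) y} pull_back"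
    unfolding enc by (rule ptime_polytime_on[OF ptime_pull_back])
  fix x assume x: "x \<in> instances ?P"
  obtain \<Gamma> xs where x_eq: "x = (\<Gamma>, xs)" by (cases x)
  interpret instance_k k \<Gamma> xs
  proof
    show "fst C \<le> snd C \<and> snd C - fst C \<le> of_nat k" if "C \<in> set \<Gamma>" for C
      using x that by (auto simp: DISC_SC_k_def x_eq)
    show "unit_length (set xs)"
      using x by (auto simp: DISC_SC_k_def x_eq unit_length_def algebra_simps)
  qed
  have feas: "feasible ?P x = {A. segment_cover (set \<Gamma>) (set xs) (set A)}"
    by (simp add: DISC_SC_k_def x_eq)
  have feas': "feasible ?Q (reduction x) = {S. temporal_separator V E 0 1 1 (set S)}"
    unfolding x_eq by (rule feasible_reduction)
  \<comment> \<open>\<open>push\<close> and \<open>pull\<close> transport feasible solutions in both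
    directions without increasing the objective. This yields the equivalence for every threshold as
    well as the transfer of optimality.\<close>
  have push: "\<exists>S\<in>feasible ?Q (reduction x). objective ?Q S \<le> objective ?P A" if "A \<in> feasible ?P x" for A
  proof (rule bexI)
    show "map (ivertex xs) A \<in> feasible ?Q (reduction x)"
      using that separator_of_cover by (simp add: feas feas')
    show "objective ?Q (map (ivertex xs) A) \<le> objective ?P A"
      by (simp add: obj card_image_le)
  qed
  have pull: "pull_back (x, S) \<in> feasible ?P x" "objective ?P (pull_back (x, S)) \<le> objective ?Q S"
    if "S \<in> feasible ?Q (reduction x)" for S
    using that cover_of_separator[of S] card_pull_back_le[of S]
    unfolding feas feas' obj by (simp_all add: x_eq)
  show "reduction x \<in> instances ?Q" unfolding x_eq by (rule reduction_instance)
  show "\<forall>q. (\<exists>y\<in>feasible ?P x. objective ?P y \<le> q) \<longleftrightarrow>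
      (\<exists>y\<in>feasible ?Q (reduction x). objective ?Q y \<le> snd (x, q))"
    unfolding snd_conv
  proof (intro allI iffI; elim bexE)
    fix q A assume "A \<in> feasible ?P x" "objective ?P A \<le> q"
    then show "\<exists>y\<in>feasible ?Q (reduction x). objective ?Q y \<le> q"
      using push[of A] order_trans by blast
  next
    fix q S assume "S \<in> feasible ?Q (reduction x)" "objective ?Q S \<le> q"
    then show "\<exists>y\<in>feasible ?P x. objective ?P y \<le> q"
      using pull[of S] order_trans by blast
  qed
  show "\<forall>y. optimal ?Q (reduction x) y \<longrightarrow> optimal ?P x (pull_back (x, y))"
    unfolding optimal_def
  proof (intro allI impI conjI ballI; elim conjE)
    fix S A
    assume S: "S \<in> feasible ?Q (reduction x)"
    show "pull_back (x, S) \<in> feasible ?P x" by (rule pull(1)[OF S])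
    assume opt: "\<forall>S'\<in>feasible ?Q (reduction x). objective ?Q S \<le> objective ?Q S'"
      and A: "A \<in> feasible ?P x"
    obtain S' where "S' \<in> feasible ?Q (reduction x)" "objective ?Q S' \<le> objective ?P A"
      using push[OF A] by blast
    then have "objective ?Q S \<le> objective ?P A" using opt order_trans by blast
    then show "objective ?P (pull_back (x, S)) \<le> objective ?P A"
      using pull(2)[OF S] by (rule order_trans[rotated])
  qed
qed

end
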